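(* Let $\square_d$ be the $d$-dimensional (combinatorial) cube, and let $\mathcal{D}$ be a subcomplex of $\mathcal{C}(\square_d)$. Then the following are equivalent: (1) The relative complex $\mathcal{C}(\square_d)\setminus\mathcal{D}$ is stable. (2) $\mathcal{C}(\square_d)\setminus\mathcal{D}$ has geometric realization $[-1,1]^d_\ell$ for some $0\le\ell\le 2d$. (3) The set of codimension $1$ faces of $\mathcal{C}(\square_d)\setminus\mathcal{D}$ or the set of facets of $\mathcal{D}$ does not contain an opposing pair (that is, at least one of these two sets contains no opposing pair).
   Context: For a polytope $P$, $\mathcal{C}(P)$ is the polytopal complex of all faces of $P$ (including $\emptyset$ and $P$); for a finite collection of polytopes, $\mathcal{C}(\{P_1,\ldots,P_m\})=\bigcup_i\mathcal{C}(P_i)$ (having no faces at all if the collection is empty). A subcomplex of a polytopal complex $\mathcal{C}$ is a polytopal complex $\mathcal{D}$ all of whose faces are faces of $\mathcal{C}$ (the case $\mathcal{D}=\emptyset$, with no faces at all, is allowed); the facets of a complex are its inclusion-maximal faces. If $\mathcal{D}$ is a subcomplex of $\mathcal{C}$, then $\mathcal{C}\setminus\mathcal{D}=\{Q\in\mathcal{C}:Q\notin\mathcal{D}\}$ is called a relative complex. For a polytope $P$, let $L(P)$ be its face lattice, $[F,P]$ the closed interval of faces containing $F$, ${}^\ast$ the dual poset, and $A(\cdot)$ the set of atoms of a poset with a least element. Thus $A([F,P]^\ast)$ is the set of facets of $P$ containing $F$ (empty if $F=P$, all facets if $F=\emptyset$), and $A(L(P)^\ast)$ is the set of all facets of $P$.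 The reciprocal domains associated to a face $F$ of $P$ are $$\mathcal{C}(P)\setminus\mathcal{C}(A([F,P]^\ast))\quad\text{and}\quad \mathcal{C}(P)\setminus\mathcal{C}(A(L(P)^\ast)\setminus A([F,P]^\ast)).$$ A relative complex is stable if it is isomorphic to one of the reciprocal domains associated to some face $F$ (possibly $\emptyset$ or $P$) of some polytope $P$; here $\mathcal{C}\setminus\mathcal{D}$ and $\mathcal{C}'\setminus\mathcal{D}'$ are isomorphic if there is an inclusion-preserving (both ways) bijection $\mathcal{C}\to\mathcal{C}'$ mapping $\mathcal{D}$ onto $\mathcal{D}'$. Identify the facets of $\square_d$ with the facets of $[-1,1]^d$ defined by the hyperplanes $x_i=\pm1$. Two facets of $\square_d$ form an opposing pair if they correspond to $x_i=1$ and $x_i=-1$ for the same $i\in[d]=\{1,\ldots,d\}$. The half-open cubes are $[-1,1]^d_\ell:=[-1,1]^d\setminus\{x_d=1,\ldots,x_{d+1-\ell}=1\}$ for $0\le\ell\le d$, and $[-1,1]^d_\ell:=[-1,1]^d\setminus(\{x_d=1,\ldots,x_1=1\}\cup\{x_d=-1,\ldots,x_{2d+1-\ell}=-1\})$ for $d+1\le\ell\le 2d$ (all points on the listed hyperplanes are removed). "$\mathcal{C}(\square_d)\setminus\mathcal{D}$ has geometric realization $[-1,1]^d_\ell$" means that there is an isomorphism from the face lattice of $\square_d$ to that of $[-1,1]^d$ taking $\mathcal{D}$ onto the set of all faces of the facets removed in $[-1,1]^d_\ell$ (no faces at all if $\ell=0$).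
   Formalization: (3)⇒(1) is claimed only when every facet of D is a facet of the cube (it fails for D = a single vertex of a square), and d = 0 with D = {∅} is excluded, since there (1) holds but (2) fails; (1)⇔(2) and (1)⇒(3) are stated for all other D. *)

theory Defs
  imports "HOL-Analysis.Analysis" "HOL-Analysis.Finite_Function_Topology"
begin

section \<open>Face lattices and polytopal complexes\<close>

text \<open>For a polytope this is both the complex and the face lattice (ordered by inclusion);
  \<open>face_of\<close> counts the empty set and the polytope itself as faces.\<close>

definition faces :: "'a::real_vector set \<Rightarrow> 'a set set" where
  "faces P = {G. G face_of P}"

definition generated_complex :: "'a::real_vector set set \<Rightarrow> 'a set set" where
  "generated_complex X = (\<Union>P\<in>X. faces P)"

definition polytopal_complex :: "'a::real_vector set set \<Rightarrow> bool" where
  "polytopal_complex K \<longleftrightarrow>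
     finite K \<and>
     (\<forall>P\<in>K. polytope P) \<and>
     (\<forall>P\<in>K. \<forall>G. G face_of P \<longrightarrow> G \<in> K) \<and>
     (\<forall>P\<in>K. \<forall>P'\<in>K. (P \<inter> P') face_of P \<and> (P \<inter> P') face_of P')"

definition subcomplex :: "'a::real_vector set set \<Rightarrow> 'a set set \<Rightarrow> bool" where
  "subcomplex D K \<longleftrightarrow> polytopal_complex D \<and> D \<subseteq> K"

definition complex_facets :: "'a set set \<Rightarrow> 'a set set" where
  "complex_facets K = {G \<in> K. \<forall>H\<in>K. G \<subseteq> H \<longrightarrow> H = G}"

definition inclusion_iso :: "('a set \<Rightarrow> 'b set) \<Rightarrow> 'a set set \<Rightarrow> 'b set set \<Rightarrow> bool" where
  "inclusion_iso f K K' \<longleftrightarrow>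
     bij_betw f K K' \<and> (\<forall>G\<in>K. \<forall>H\<in>K. G \<subseteq> H \<longleftrightarrow> f G \<subseteq> f H)"


section \<open>Reciprocal domains and stable relative complexes\<close>

definition atoms :: "('a \<Rightarrow> 'a \<Rightarrow> bool) \<Rightarrow> 'a set \<Rightarrow> 'a set" where
  "atoms le L = {a \<in> L. \<exists>b\<in>L. (\<forall>x\<in>L. le b x) \<and> a \<noteq> b \<and> (\<forall>x\<in>L. le x a \<longrightarrow> x = b \<or> x = a)}"

definition face_interval :: "'a::real_vector set \<Rightarrow> 'a set \<Rightarrow> 'a set set" where
  "face_interval F P = {G \<in> faces P. F \<subseteq> G}"

text \<open>The atoms of the dual of the interval from \<open>F\<close> to \<open>P\<close>, i.e. the facets of \<open>P\<close> containing
  \<open>F\<close>. Taken in the lattice sense, so the empty set is a facet of a single point (in contrast to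
  \<open>facet_of\<close>).\<close>

definition facets_above :: "'a::real_vector set \<Rightarrow> 'a set \<Rightarrow> 'a set set" where
  "facets_above F P = atoms (\<supseteq>) (face_interval F P)"

definition all_facets :: "'a::real_vector set \<Rightarrow> 'a set set" where
  "all_facets P = atoms (\<supseteq>) (faces P)"

text \<open>A relative complex is represented by the pair \<open>K\<close>, \<open>D\<close>: isomorphisms are maps of \<open>K\<close>
  respecting \<open>D\<close>, so the set difference alone does not carry enough information.\<close>

definition relative_iso ::
  "'a set set \<Rightarrow> 'a set set \<Rightarrow> 'b set set \<Rightarrow> 'b set set \<Rightarrow> bool" where
  "relative_iso K D K' D' \<longleftrightarrow> (\<exists>f. inclusion_iso f K K' \<and> f ` D = D')"

text \<open>The polytope \<open>P\<close> may have any dimension. To quantify over all of them at once, they are taken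
  in the space of finitely supported real sequences: every polytope in a Euclidean space has an
  affine copy there, and every polytope there lies in a finite-dimensional subspace.\<close>

definition stable_complex :: "'a set set \<Rightarrow> 'a set set \<Rightarrow> bool" where
  "stable_complex K D \<longleftrightarrow>
     (\<exists>(P :: (nat \<Rightarrow>\<^sub>0 real) set) F. polytope P \<and> F face_of P \<and>
        (relative_iso K D (faces P) (generated_complex (facets_above F P)) \<or>
         relative_iso K D (faces P) (generated_complex (all_facets P - facets_above F P))))"


section \<open>Cubes\<close>

text \<open>The coordinates are numbered \<open>1, \<dots>, d\<close>.\<close>

definition std_cube :: "nat \<Rightarrow> (nat \<Rightarrow>\<^sub>0 real) set" where
  "std_cube d = {x. Poly_Mapping.keys x \<subseteq> {1..d} \<and>
                    (\<forall>i\<in>{1..d}. -1 \<le> Poly_Mapping.lookup x i \<and> Poly_Mapping.lookup x i \<le> 1)}"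

definition cube_facet :: "nat \<Rightarrow> nat \<Rightarrow> real \<Rightarrow> (nat \<Rightarrow>\<^sub>0 real) set" where
  "cube_facet d i s = {x \<in> std_cube d. Poly_Mapping.lookup x i = s}"

text \<open>Meant for \<open>l \<le> 2 * d\<close>; the truncated subtractions are then exact.\<close>

definition removed_facets :: "nat \<Rightarrow> nat \<Rightarrow> (nat \<Rightarrow>\<^sub>0 real) set set" where
  "removed_facets d l =
     (if l \<le> d then {cube_facet d i 1 |i. i \<in> {d + 1 - l..d}}
      else {cube_facet d i 1 |i. i \<in> {1..d}} \<union> {cube_facet d i (-1) |i. i \<in> {2 * d + 1 - l..d}})"

definition half_open_cube :: "nat \<Rightarrow> nat \<Rightarrow> (nat \<Rightarrow>\<^sub>0 real) set" where
  "half_open_cube d l = std_cube d - \<Union>(removed_facets d l)"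

text \<open>\<open>X\<close> is the cube with some facets removed (all their points); these are the facets which \<open>X\<close>
  does not meet. Lemma \<open>removed_facets_eq\<close> below confirms this for the half-open cubes.\<close>

definition has_geometric_realization ::
  "nat \<Rightarrow> 'a::real_vector set \<Rightarrow> 'a set set \<Rightarrow> (nat \<Rightarrow>\<^sub>0 real) set \<Rightarrow> bool" where
  "has_geometric_realization d Q D X \<longleftrightarrow>
     (\<exists>f. inclusion_iso f (faces Q) (faces (std_cube d)) \<and>
          f ` D = generated_complex {cube_facet d i s |i s. i \<in> {1..d} \<and> s \<in> {-1, 1} \<and>
                                       cube_facet d i s \<inter> X = {}})"

lemma removed_facets_eq:
  assumes "l \<le> 2 * d"
  shows "{cube_facet d i s |i s. i \<in> {1..d} \<and> s \<in> {-1, 1} \<and>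
            cube_facet d i s \<inter> half_open_cube d l = {}} = removed_facets d l"
    (is "?L = ?R")
proof
  show "?R \<subseteq> ?L"
    using assms unfolding removed_facets_def half_open_cube_def
    by (auto split: if_splits; force)
  show "?L \<subseteq> ?R"
  proof
    fix G assume "G \<in> ?L"
    then obtain i s where ids: "i \<in> {1..d}" "s \<in> {-1, 1}" and G: "G = cube_facet d i s"
      and disj: "cube_facet d i s \<inter> half_open_cube d l = {}" by auto
    define x where "x = Poly_Mapping.single i s"
    have x: "x \<in> cube_facet d i s"
      using ids by (auto simp: x_def cube_facet_def std_cube_def lookup_single when_def)
    then have "x \<in> std_cube d" by (simp add: cube_facet_def)
    with x disj obtain H where H: "H \<in> removed_facets d l" "x \<in> H"
      by (auto simp: half_open_cube_def)
    then obtain j t where jt: "H = cube_facet d j t" "t \<in> {-1, 1}"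
      by (auto simp: removed_facets_def split: if_splits)
    with H(2) have "Poly_Mapping.lookup x j = t" by (simp add: cube_facet_def)
    with jt(2) have "j = i \<and> t = s"
      by (auto simp: x_def lookup_single when_def split: if_splits)
    with H(1) jt(1) G show "G \<in> ?R" by simp
  qed
qed

text \<open>\<open>f\<close> is the isomorphism identifying the faces of the combinatorial cube \<open>Q\<close> with those of
  the standard cube.\<close>

definition opposing_pair ::
  "nat \<Rightarrow> 'a::euclidean_space set \<Rightarrow> ('a set \<Rightarrow> (nat \<Rightarrow>\<^sub>0 real) set) \<Rightarrow> 'a set \<Rightarrow> 'a set \<Rightarrow> bool" where
  "opposing_pair d Q f G H \<longleftrightarrow> G facet_of Q \<and> H facet_of Q \<and>
     (\<exists>i\<in>{1..d}. {f G, f H} = {cube_facet d i 1, cube_facet d i (-1)})"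

definition contains_opposing_pair ::
  "nat \<Rightarrow> 'a::euclidean_space set \<Rightarrow> ('a set \<Rightarrow> (nat \<Rightarrow>\<^sub>0 real) set) \<Rightarrow> 'a set set \<Rightarrow> bool" where
  "contains_opposing_pair d Q f X \<longleftrightarrow> (\<exists>G\<in>X. \<exists>H\<in>X. opposing_pair d Q f G H)"

definition codim1_faces :: "'a::euclidean_space set \<Rightarrow> 'a set set \<Rightarrow> 'a set set" where
  "codim1_faces Q D = {G \<in> faces Q - D. aff_dim G = aff_dim Q - 1}"

text \<open>Pitfall: facets of \<open>D\<close> that are not facets of \<open>Q\<close> never occur in an opposing pair, so the
  condition holds vacuously for, say, a single vertex \<open>D\<close> of a square, whose relative complex is not
  stable.\<close>

definition no_opposing_pair_condition ::
  "nat \<Rightarrow> 'a::euclidean_space set \<Rightarrow> ('a set \<Rightarrow> (nat \<Rightarrow>\<^sub>0 real) set) \<Rightarrow> 'a set set \<Rightarrow> bool" where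
  "no_opposing_pair_condition d Q f D \<longleftrightarrow>
     \<not> contains_opposing_pair d Q f (codim1_faces Q D) \<or>
     \<not> contains_opposing_pair d Q f (complex_facets D)"

end

theory Submission
  imports Defs
begin

text \<open>Everything is transported to the standard cube along the given isomorphism. A nonempty face of
  the cube is the intersection of the facets containing it, and a set of facets arises in this way
  if and only if it contains no opposing pair; the empty face lies in all facets. Hence the stable
  relative complexes are those given by a set of facets that is free of opposing pairs or whose
  complement is. A signed permutation of the coordinates carries an opposing-free set of \<open>m\<close> facets
  to \<open>m\<close> facets of one sign in prescribed coordinates, and so the removed facets, or their
  complement, to the standard position used for the half-open cubes.\<close>

section \<open>Isomorphisms of face lattices\<close>

text \<open>Facets are treated as coatoms of the face lattice, a notion that every order isomorphism
  preserves, whereas an isomorphism says nothing directly about affine dimension. Dimension 0 is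
  then exceptional: the empty face is a coatom of the lattice of a point, so \<open>D = {{}}\<close>
  gives a stable complex (take \<open>F = {}\<close>), while the only half-open cube of dimension 0
  has \<open>l = 0\<close> and removes no face at all. Hence the exclusion of \<open>{{}}\<close>
  for \<open>d = 0\<close>. The standard cube lies in an infinite-dimensional space, and its coatoms
  are found directly, from the fact that a face through a point with all coordinates of modulus
  below 1 is the whole cube. Dimension enters only for \<open>Q\<close>, where
  \<open>facet_of\<close> is matched with the nonempty coatoms. The third condition sees only those
  facets of \<open>D\<close> that are facets of \<open>Q\<close>. The way back from it therefore
  assumes that all facets of \<open>D\<close> are of this kind, so that a set of cube facets
  determines \<open>D\<close>.\<close>

lemma mem_all_facets_iff:
  assumes "convex P"
  shows "G \<in> all_facets P \<longleftrightarrow>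
    G \<in> faces P \<and> G \<noteq> P \<and> (\<forall>H\<in>faces P. G \<subseteq> H \<longrightarrow> H = P \<or> H = G)"
proof -
  have P: "P \<in> faces P" and sub: "\<forall>H\<in>faces P. H \<subseteq> P"
    using assms by (auto simp: faces_def face_of_refl dest: face_of_imp_subset)
  \<comment> \<open>In the reversed order only \<open>P\<close> can be the least element that
    \<open>atoms\<close> asks for, so the existential quantifier collapses.\<close>
  have "B = P" if "B \<in> faces P" "\<forall>H\<in>faces P. H \<subseteq> B" for B
    using that P sub by (intro subset_antisym) simp_all
  then have "(\<exists>B\<in>faces P. (\<forall>H\<in>faces P. H \<subseteq> B) \<and> R B) \<longleftrightarrow> R P" for R
    using P sub by metis
  then show ?thesis
    unfolding all_facets_def atoms_def by simp
qed

text \<open>The interval has the same top \<open>P\<close> as the whole lattice, and a face above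
  \<open>G\<close> contains \<open>F\<close> whenever \<open>G\<close> does. Maximality among the
  proper faces thus means the same in both.\<close>

lemma facets_above_eq:
  assumes "convex P" "F \<in> faces P"
  shows "facets_above F P = {G \<in> all_facets P. F \<subseteq> G}"
proof (intro equalityI subsetI)
  have P: "P \<in> faces P" "F \<subseteq> P" and sub: "\<And>H. H \<in> faces P \<Longrightarrow> H \<subseteq> P"
    using assms by (auto simp: faces_def face_of_refl dest: face_of_imp_subset)
  show "G \<in> {G \<in> all_facets P. F \<subseteq> G}" if "G \<in> facets_above F P" for G
  proof -
    have "G \<in> face_interval F P \<and> (\<exists>B\<in>face_interval F P.
        (\<forall>H\<in>face_interval F P. H \<subseteq> B) \<and> G \<noteq> B \<and>
        (\<forall>H\<in>face_interval F P. G \<subseteq> H \<longrightarrow> H = B \<or> H = G))"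
      using that unfolding facets_above_def atoms_def by simp
    then obtain B where "G \<in> face_interval F P" "B \<in> face_interval F P" "G \<noteq> B"
      "\<forall>H\<in>face_interval F P. H \<subseteq> B"
      "\<forall>H\<in>face_interval F P. G \<subseteq> H \<longrightarrow> H = B \<or> H = G"
      by (elim conjE bexE)
    then have G: "G \<in> faces P" "F \<subseteq> G" "B \<in> faces P" "G \<noteq> B"
      and B: "\<And>H. H \<in> faces P \<Longrightarrow> F \<subseteq> H \<Longrightarrow> H \<subseteq> B"
      and max: "\<And>H. H \<in> faces P \<Longrightarrow> F \<subseteq> H \<Longrightarrow> G \<subseteq> H \<Longrightarrow> H = B \<or> H = G"
      by (simp_all add: face_interval_def)
    have "B = P"
      using B[OF P] sub[OF G(3)] by (rule subset_antisym[rotated])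
    moreover have "H = P \<or> H = G" if "H \<in> faces P" "G \<subseteq> H" for H
      using max[OF that(1) order_trans[OF G(2) that(2)] that(2)] \<open>B = P\<close> by simp
    ultimately show ?thesis
      using G unfolding mem_Collect_eq mem_all_facets_iff[OF assms(1)] by simp
  qed
  show "G \<in> facets_above F P" if "G \<in> {G \<in> all_facets P. F \<subseteq> G}" for G
  proof -
    have G: "G \<in> faces P" "F \<subseteq> G" "G \<noteq> P"
      "\<And>H. H \<in> faces P \<Longrightarrow> G \<subseteq> H \<Longrightarrow> H = P \<or> H = G"
      using that by (simp_all add: mem_all_facets_iff[OF assms(1)])
    show ?thesis
      unfolding facets_above_def atoms_def face_interval_def mem_Collect_eq
      by (intro conjI bexI[of _ P] ballI impI) (simp_all add: G P sub)
  qed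
qed

text \<open>A face of a face is just a smaller face. This turns the generated complex into a
  down-set of the lattice, which isomorphisms carry along.\<close>

lemma generated_complex_eq:
  assumes "X \<subseteq> faces P"
  shows "generated_complex X = {G \<in> faces P. \<exists>H\<in>X. G \<subseteq> H}"
proof -
  have "faces H = {G \<in> faces P. G \<subseteq> H}" if "H \<in> X" for H
  proof -
    have "H face_of P" using that assms by (auto simp: faces_def)
    then show ?thesis by (simp add: faces_def face_of_face)
  qed
  then have "generated_complex X = (\<Union>H\<in>X. {G \<in> faces P. G \<subseteq> H})"
    unfolding generated_complex_def by (rule SUP_cong[OF refl])
  then show ?thesis by blast
qed

lemma inclusion_iso_compose:
  assumes f: "inclusion_iso f K L" and g: "inclusion_iso g L M"
  shows "inclusion_iso (g \<circ> f) K M"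
  unfolding inclusion_iso_def
proof (intro conjI ballI)
  have bij: "bij_betw f K L" "bij_betw g L M"
    using f g by (simp_all add: inclusion_iso_def)
  show "bij_betw (g \<circ> f) K M"
    using bij by (rule bij_betw_trans)
  fix G H assume GH: "G \<in> K" "H \<in> K"
  then have "f G \<in> L" "f H \<in> L"
    using bij(1) by (simp_all add: bij_betwE)
  with GH show "G \<subseteq> H \<longleftrightarrow> (g \<circ> f) G \<subseteq> (g \<circ> f) H"
    using f g by (simp add: inclusion_iso_def)
qed

lemma inclusion_iso_inv_into:
  assumes f: "inclusion_iso f K L"
  shows "inclusion_iso (inv_into K f) L K"
  unfolding inclusion_iso_def
proof (intro conjI ballI)
  have bij: "bij_betw f K L"
    using f by (simp add: inclusion_iso_def)
  then show "bij_betw (inv_into K f) L K"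
    by (rule bij_betw_inv_into)
  have inv: "inv_into K f G \<in> K" "f (inv_into K f G) = G" if "G \<in> L" for G
    using that bij by (auto simp: bij_betw_def inv_into_into f_inv_into_f)
  fix G H assume GH: "G \<in> L" "H \<in> L"
  have "inv_into K f G \<subseteq> inv_into K f H \<longleftrightarrow> f (inv_into K f G) \<subseteq> f (inv_into K f H)"
    using f inv(1) GH unfolding inclusion_iso_def by blast
  then show "G \<subseteq> H \<longleftrightarrow> inv_into K f G \<subseteq> inv_into K f H"
    using inv(2) GH by simp
qed

lemma image_restrict_eq:
  assumes "\<And>x. x \<in> A \<Longrightarrow> R (f x) \<longleftrightarrow> S x"
  shows "f ` {x \<in> A. S x} = {y \<in> f ` A. R y}"
  using assms by auto

text \<open>Convexity makes each of the two sets a face of itself, hence the top of its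
  lattice.\<close>

locale face_lattice_iso =
  fixes f :: "'a::real_vector set \<Rightarrow> 'b::real_vector set" and P Q
  assumes iso: "inclusion_iso f (faces P) (faces Q)"
    and convex: "convex P" "convex Q"
begin

lemma bij: "bij_betw f (faces P) (faces Q)"
  using iso by (simp add: inclusion_iso_def)

lemma image_faces: "f ` faces P = faces Q"
  using bij by (simp add: bij_betw_def)

lemma maps_faces: "G \<in> faces P \<Longrightarrow> f G \<in> faces Q"
  using image_faces by blast

lemma le_iff: "G \<in> faces P \<Longrightarrow> H \<in> faces P \<Longrightarrow> f G \<subseteq> f H \<longleftrightarrow> G \<subseteq> H"
  using iso by (simp add: inclusion_iso_def)

lemma eq_iff: "G \<in> faces P \<Longrightarrow> H \<in> faces P \<Longrightarrow> f G = f H \<longleftrightarrow> G = H"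
  using bij by (meson bij_betw_imp_inj_on inj_on_eq_iff)

lemma top_face: "P \<in> faces P" "Q \<in> faces Q"
  using convex by (auto simp: faces_def face_of_refl)

lemma map_top: "f P = Q"
proof -
  obtain G where G: "Q = f G" "G \<in> faces P"
    using top_face(2) unfolding image_faces[symmetric] by (rule imageE)
  then have "Q \<subseteq> f P"
    using le_iff[OF G(2) top_face(1)] by (simp add: faces_def face_of_imp_subset)
  moreover have "f P \<subseteq> Q"
    using maps_faces[OF top_face(1)] by (simp add: faces_def face_of_imp_subset)
  ultimately show ?thesis by simp
qed

lemma map_bot: "f {} = {}"
proof -
  have bot: "{} \<in> faces P" "{} \<in> faces Q"
    by (simp_all add: faces_def)
  obtain G where G: "{} = f G" "G \<in> faces P"
    using bot(2) unfolding image_faces[symmetric] by (rule imageE)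
  then show ?thesis
    using le_iff[OF bot(1) G(2)] by simp
qed

lemma mem_all_facets:
  assumes "G \<in> faces P"
  shows "f G \<in> all_facets Q \<longleftrightarrow> G \<in> all_facets P"
proof -
  have "(\<forall>H\<in>faces Q. f G \<subseteq> H \<longrightarrow> H = Q \<or> H = f G) \<longleftrightarrow>
        (\<forall>H\<in>faces P. f G \<subseteq> f H \<longrightarrow> f H = Q \<or> f H = f G)"
    unfolding image_faces[symmetric] by blast
  also have "\<dots> \<longleftrightarrow> (\<forall>H\<in>faces P. G \<subseteq> H \<longrightarrow> H = P \<or> H = G)"
    using assms top_face(1) by (auto simp: le_iff eq_iff simp flip: map_top)
  finally have "(\<forall>H\<in>faces Q. f G \<subseteq> H \<longrightarrow> H = Q \<or> H = f G) \<longleftrightarrow>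
    (\<forall>H\<in>faces P. G \<subseteq> H \<longrightarrow> H = P \<or> H = G)" .
  moreover have "f G = Q \<longleftrightarrow> G = P"
    using eq_iff[OF assms top_face(1)] unfolding map_top .
  ultimately show ?thesis
    using assms maps_faces[OF assms]
    unfolding mem_all_facets_iff[OF convex(1)] mem_all_facets_iff[OF convex(2)] by argo
qed

lemma image_all_facets: "f ` all_facets P = all_facets Q"
proof (intro equalityI subsetI)
  fix H assume "H \<in> f ` all_facets P"
  then obtain G where G: "H = f G" "G \<in> all_facets P"
    by (rule imageE)
  then have "G \<in> faces P"
    using convex(1) by (simp add: mem_all_facets_iff)
  then show "H \<in> all_facets Q"
    using mem_all_facets G by simp
next
  fix H assume H: "H \<in> all_facets Q"
  then have "H \<in> f ` faces P"
    using convex(2) by (simp add: mem_all_facets_iff image_faces)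
  then obtain G where G: "H = f G" "G \<in> faces P"
    by (rule imageE)
  then have "G \<in> all_facets P"
    using H mem_all_facets[OF G(2)] by simp
  then show "H \<in> f ` all_facets P"
    unfolding G(1) by (rule imageI)
qed

lemma image_facets_above:
  assumes "F \<in> faces P"
  shows "f ` facets_above F P = facets_above (f F) Q"
proof -
  have "f F \<subseteq> f G \<longleftrightarrow> F \<subseteq> G" if "G \<in> all_facets P" for G
    using that assms convex(1) by (simp add: mem_all_facets_iff le_iff)
  then have "f ` {G \<in> all_facets P. F \<subseteq> G} = {H \<in> f ` all_facets P. f F \<subseteq> H}"
    by (rule image_restrict_eq)
  then show ?thesis
    unfolding facets_above_eq[OF convex(1) assms] facets_above_eq[OF convex(2) maps_faces[OF assms]]
      image_all_facets .
qed

lemma image_generated_complex: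
  assumes "X \<subseteq> faces P"
  shows "f ` generated_complex X = generated_complex (f ` X)"
proof -
  have X: "f ` X \<subseteq> faces Q"
    unfolding image_faces[symmetric] using assms by (rule image_mono)
  have "(\<exists>H\<in>X. f G \<subseteq> f H) \<longleftrightarrow> (\<exists>H\<in>X. G \<subseteq> H)" if "G \<in> faces P" for G
    using le_iff[OF that] assms by (metis subsetD)
  then have "f ` {G \<in> faces P. \<exists>H\<in>X. G \<subseteq> H} = {K \<in> f ` faces P. \<exists>H\<in>f ` X. K \<subseteq> H}"
    by (intro image_restrict_eq) simp
  then show ?thesis
    unfolding generated_complex_eq[OF assms] generated_complex_eq[OF X] image_faces .
qed

lemma image_diff:
  assumes "X \<subseteq> faces P" "Y \<subseteq> faces P"
  shows "f ` (X - Y) = f ` X - f ` Y"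
proof (rule inj_on_image_set_diff[OF _ _ assms(2)])
  show "inj_on f (faces P)"
    using bij by (rule bij_betw_imp_inj_on)
  show "X - Y \<subseteq> faces P"
    using assms(1) by (rule order_trans[OF Diff_subset])
qed

end

lemma facets_subset_faces: "facets_above F P \<subseteq> faces P" "all_facets P \<subseteq> faces P"
  by (auto simp: facets_above_def all_facets_def face_interval_def atoms_def)

text \<open>Reciprocal domains depend on the order alone, so the polytope witnessing stability may
  be replaced by the isomorphic \<open>C\<close>, along the inverse of \<open>h\<close> followed by
  \<open>f\<close>. Conversely, \<open>C\<close> lies in the space over which
  \<open>stable_complex\<close> quantifies and is itself a witness.\<close>

lemma stable_complex_iff:
  fixes C :: "(nat \<Rightarrow>\<^sub>0 real) set"
  assumes "inclusion_iso f (faces Q) (faces C)" "convex Q" "polytope C" "D \<subseteq> faces Q"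
  shows "stable_complex (faces Q) D \<longleftrightarrow>
    (\<exists>F\<in>faces C. f ` D = generated_complex (facets_above F C) \<or>
                 f ` D = generated_complex (all_facets C - facets_above F C))"
    (is "?L \<longleftrightarrow> ?R")
proof
  assume ?L
  then obtain P :: "(nat \<Rightarrow>\<^sub>0 real) set" and F h where P: "polytope P" "F \<in> faces P"
    and h: "inclusion_iso h (faces Q) (faces P)"
    and D: "h ` D = generated_complex (facets_above F P) \<or>
      h ` D = generated_complex (all_facets P - facets_above F P)"
    unfolding stable_complex_def relative_iso_def faces_def by blast
  define k where "k = f \<circ> inv_into (faces Q) h"
  interpret face_lattice_iso k P C
    using P assms inclusion_iso_compose[OF inclusion_iso_inv_into[OF h] assms(1)]
    by unfold_locales (auto simp: k_def polytope_imp_convex)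
  have inj: "inj_on h (faces Q)"
    using h by (simp add: inclusion_iso_def bij_betw_def)
  have kh: "k ` h ` D = f ` D"
    unfolding image_image
  proof (rule image_cong[OF refl])
    fix G assume "G \<in> D"
    then have "G \<in> faces Q" using assms(4) by (rule rev_subsetD)
    then show "k (h G) = f G" by (simp add: k_def inv_into_f_f[OF inj])
  qed
  have "k ` generated_complex (facets_above F P) = generated_complex (facets_above (k F) C)"
    by (simp only: image_generated_complex[OF facets_subset_faces(1)] image_facets_above[OF P(2)])
  moreover have "k ` generated_complex (all_facets P - facets_above F P) =
      generated_complex (all_facets C - facets_above (k F) C)"
    by (simp only: image_generated_complex[OF order_trans[OF Diff_subset facets_subset_faces(2)]]
        image_diff[OF facets_subset_faces(2,1)] image_facets_above[OF P(2)] image_all_facets)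
  ultimately have "f ` D = generated_complex (facets_above (k F) C) \<or>
      f ` D = generated_complex (all_facets C - facets_above (k F) C)"
    using D kh by metis
  then show ?R
    using maps_faces[OF P(2)] by (rule bexI)
next
  assume ?R
  then obtain F where F: "F face_of C"
    "f ` D = generated_complex (facets_above F C) \<or>
     f ` D = generated_complex (all_facets C - facets_above F C)"
    by (auto simp: faces_def)
  from F(2) have "relative_iso (faces Q) D (faces C) (generated_complex (facets_above F C)) \<or>
      relative_iso (faces Q) D (faces C) (generated_complex (all_facets C - facets_above F C))"
    unfolding relative_iso_def using assms(1) by (elim disjE) auto
  then show ?L
    unfolding stable_complex_def using assms(3) F(1) by (intro exI conjI)
qed

section \<open>Facets of the cube\<close>

definition cube_facets :: "nat \<Rightarrow> (nat \<Rightarrow>\<^sub>0 real) set set" where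
  "cube_facets d = {cube_facet d i s |i s. i \<in> {1..d} \<and> s \<in> {-1, 1}}"

section \<open>Coordinates of the cube, its vertices and the faces on the hyperplanes\<close>

lemma lookup_scaleR [simp]:
  "Poly_Mapping.lookup (c *\<^sub>R x) i = c *\<^sub>R Poly_Mapping.lookup x i"
proof -
  have "finite {i. c *\<^sub>R Poly_Mapping.lookup x i \<noteq> 0}"
    by (rule finite_subset[OF _ finite_keys[of x]]) (auto simp: in_keys_iff)
  then show ?thesis
    by (simp add: scaleR_poly_mapping_def)
qed

lemma lookup_sum_poly_mapping:
  "Poly_Mapping.lookup (\<Sum>i\<in>A. x i) k = (\<Sum>i\<in>A. Poly_Mapping.lookup (x i) k)"
  by (induction A rule: infinite_finite_induct) (auto simp: lookup_add)

lemma mem_std_cube_iff: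
  "x \<in> std_cube d \<longleftrightarrow> (\<forall>i. \<bar>Poly_Mapping.lookup x i\<bar> \<le> (if i \<in> {1..d} then 1 else 0))"
proof -
  have "Poly_Mapping.keys x \<subseteq> {1..d} \<longleftrightarrow> (\<forall>i. i \<notin> {1..d} \<longrightarrow> Poly_Mapping.lookup x i = 0)"
    unfolding in_keys_iff subset_iff by blast
  moreover have "\<bar>Poly_Mapping.lookup x i\<bar> \<le> (if i \<in> {1..d} then 1 else 0) \<longleftrightarrow>
      (i \<notin> {1..d} \<longrightarrow> Poly_Mapping.lookup x i = 0) \<and>
      (i \<in> {1..d} \<longrightarrow> -1 \<le> Poly_Mapping.lookup x i \<and> Poly_Mapping.lookup x i \<le> 1)" for i
    by (cases "i \<in> {1..d}") (simp_all only: if_True if_False, auto simp: abs_le_iff)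
  ultimately show ?thesis
    unfolding std_cube_def mem_Collect_eq by blast
qed

text \<open>Adding a dimension is a Minkowski sum with a segment. As convex hulls commute with
  Minkowski sums, induction yields a finite set spanning the cube.\<close>

lemma std_cube_Suc:
  "std_cube (Suc d) =
   std_cube d + convex hull {Poly_Mapping.single (Suc d) (-1), Poly_Mapping.single (Suc d) 1}"
  (is "_ = _ + convex hull {?a, ?b}")
proof -
  have hull: "convex hull {?a, ?b} = Poly_Mapping.single (Suc d) ` {-1..1}"
  proof -
    have "(1 - u) *\<^sub>R ?a + u *\<^sub>R ?b = Poly_Mapping.single (Suc d) (2 * u - 1)" for u :: real
      by (rule poly_mapping_eqI) (auto simp: lookup_add lookup_single when_def)
    moreover have "{-1..1} = (\<lambda>u. 2 * u - 1) ` {0..1::real}"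
    proof (intro equalityI subsetI)
      fix x :: real assume "x \<in> {-1..1}"
      then show "x \<in> (\<lambda>u. 2 * u - 1) ` {0..1}"
        by (intro image_eqI[of _ _ "(x + 1) / 2"]) (auto simp: field_simps)
    qed auto
    ultimately show ?thesis
      by (auto simp: closed_segment_def simp flip: segment_convex_hull)
  qed
  show ?thesis
  proof (intro equalityI subsetI)
    fix x assume x: "x \<in> std_cube (Suc d)"
    let ?s = "Poly_Mapping.single (Suc d) (Poly_Mapping.lookup x (Suc d))"
    have "\<bar>Poly_Mapping.lookup x (Suc d)\<bar> \<le> 1"
      using x unfolding mem_std_cube_iff by (metis atLeastAtMost_iff le_refl One_nat_def Suc_le_mono le0)
    then have "Poly_Mapping.lookup x (Suc d) \<in> {-1..1}"
      by (simp add: abs_le_iff)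
    then have "?s \<in> convex hull {?a, ?b}"
      unfolding hull by (rule imageI)
    moreover have "x - ?s \<in> std_cube d"
      using x unfolding mem_std_cube_iff
      by (auto simp: lookup_minus lookup_single when_def le_Suc_eq split: if_splits)
    ultimately have "(x - ?s) + ?s \<in> std_cube d + convex hull {?a, ?b}"
      by (intro set_plus_intro)
    then show "x \<in> std_cube d + convex hull {?a, ?b}" by simp
  next
    fix x assume "x \<in> std_cube d + convex hull {?a, ?b}"
    then obtain y c where x: "x = y + Poly_Mapping.single (Suc d) c"
      and y: "y \<in> std_cube d" and c: "c \<in> {-1..1}"
      unfolding hull by (auto elim!: set_plus_elim)
    have bound: "\<bar>Poly_Mapping.lookup y i\<bar> \<le> (if i \<in> {1..d} then 1 else 0)" for i
      using y by (simp add: mem_std_cube_iff)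
    show "x \<in> std_cube (Suc d)"
      unfolding mem_std_cube_iff
    proof
      fix i
      show "\<bar>Poly_Mapping.lookup x i\<bar> \<le> (if i \<in> {1..Suc d} then 1 else 0)"
        using bound[of i] c
        by (cases "i = Suc d") (auto simp: x lookup_add lookup_single when_def split: if_splits)
    qed
  qed
qed

lemma std_cube_0: "std_cube 0 = {0}"
  by (auto simp: mem_std_cube_iff intro: poly_mapping_eqI)

lemma polytope_std_cube: "polytope (std_cube d)"
proof (induction d)
  case 0
  show ?case
    unfolding std_cube_0 polytope_def by (intro exI[of _ "{0}"]) simp
next
  case (Suc d)
  then obtain v where v: "finite v" "std_cube d = convex hull v"
    by (auto simp: polytope_def)
  show ?case
    unfolding polytope_def std_cube_Suc v(2) convex_hull_set_plus[symmetric]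
    by (rule exI[of _ "v + {Poly_Mapping.single (Suc d) (-1), Poly_Mapping.single (Suc d) 1}"])
      (simp add: v(1) finite_set_plus)
qed

lemma convex_std_cube: "convex (std_cube d)"
  by (simp add: polytope_std_cube polytope_imp_convex)

text \<open>The centre of the facet decides: its only nonzero coordinate is \<open>s\<close> at
  \<open>i\<close>, so it lies on no other hyperplane with right-hand side 1 or -1.\<close>

lemma cube_facet_subset_iff:
  assumes "i \<in> {1..d}" "s \<in> {-1, 1}" "t \<in> {-1, 1}"
  shows "cube_facet d i s \<subseteq> cube_facet d j t \<longleftrightarrow> i = j \<and> s = t"
proof
  assume *: "cube_facet d i s \<subseteq> cube_facet d j t"
  have "Poly_Mapping.single i s \<in> cube_facet d i s"
    using assms by (auto simp: cube_facet_def mem_std_cube_iff lookup_single when_def)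
  with * have "Poly_Mapping.lookup (Poly_Mapping.single i s) j = t"
    by (auto simp: cube_facet_def)
  then show "i = j \<and> s = t"
    using assms by (auto simp: lookup_single when_def split: if_splits)
qed auto

lemma cube_facet_eq_iff:
  assumes "i \<in> {1..d}" "s \<in> {-1, 1}" "t \<in> {-1, 1}"
  shows "cube_facet d i s = cube_facet d j t \<longleftrightarrow> i = j \<and> s = t"
  using cube_facet_subset_iff[OF assms, of j] by auto

text \<open>A proper convex combination of two numbers that are at most 1 equals 1 only if both do.
  Multiplying by \<open>s\<close>, which is its own inverse, reduces both signs to this
  case.\<close>

lemma cube_facet_face_of:
  assumes "s \<in> {-1, 1}"
  shows "cube_facet d i s face_of std_cube d"
proof -
  have *: "a = 1" if "(1 - u) * a + u * b = 1" "0 < u" "u < 1" "a \<le> 1" "b \<le> 1" for u a b :: real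
  proof (rule ccontr)
    assume "a \<noteq> 1"
    then have "(1 - u) * a < (1 - u) * 1"
      using that by (intro mult_strict_left_mono) auto
    moreover have "u * b \<le> u * 1"
      using that by (intro mult_left_mono) auto
    ultimately have "(1 - u) * a + u * b < (1 - u) * 1 + u * 1"
      by (rule add_less_le_mono)
    then show False using that(1) by simp
  qed
  have endpoint: "a = s \<and> b = s"
    if h: "(1 - u) * a + u * b = s" "0 < u" "u < 1" "\<bar>a\<bar> \<le> 1" "\<bar>b\<bar> \<le> 1" for u a b :: real
  proof -
    from assms have "s * s = 1" by auto
    have eq: "(1 - u) * (s * a) + u * (s * b) = 1"
    proof -
      have "(1 - u) * (s * a) + u * (s * b) = s * ((1 - u) * a + u * b)"
        by (simp add: algebra_simps)
      then show ?thesis using h \<open>s * s = 1\<close> by simp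
    qed
    have le: "s * a \<le> 1" "s * b \<le> 1"
      using assms h by auto
    have "s * a = 1"
      using *[OF eq] h le by simp
    moreover have "s * b = 1"
      using *[of "1 - u" "s * b" "s * a"] eq h le by simp
    ultimately show ?thesis using assms by auto
  qed
  have conv: "convex (cube_facet d i s)"
  proof -
    have "cube_facet d i s = std_cube d \<inter> {x. Poly_Mapping.lookup x i = s}"
      by (auto simp: cube_facet_def)
    moreover have "convex {x. Poly_Mapping.lookup x i = s}"
      by (auto simp: convex_def lookup_add simp flip: distrib_right)
    ultimately show ?thesis
      by (simp add: convex_Int convex_std_cube)
  qed
  have seg: "a \<in> cube_facet d i s \<and> b \<in> cube_facet d i s"
    if ab: "a \<in> std_cube d" "b \<in> std_cube d" and x: "x \<in> cube_facet d i s" "x \<in> open_segment a b"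
    for a b x
  proof -
    obtain u where u: "0 < u" "u < 1" "x = (1 - u) *\<^sub>R a + u *\<^sub>R b"
      using x(2) by (auto simp: in_segment)
    have "(1 - u) * Poly_Mapping.lookup a i + u * Poly_Mapping.lookup b i = s"
      using x(1) u(3) by (simp add: cube_facet_def lookup_add)
    moreover have "\<bar>Poly_Mapping.lookup a i\<bar> \<le> 1" "\<bar>Poly_Mapping.lookup b i\<bar> \<le> 1"
      using ab by (auto simp: mem_std_cube_iff split: if_splits
          intro: order_trans[OF _ zero_le_one] dest!: spec[of _ i])
    ultimately have "Poly_Mapping.lookup a i = s \<and> Poly_Mapping.lookup b i = s"
      by (intro endpoint[OF _ u(1,2)])
    then show ?thesis
      using ab by (simp add: cube_facet_def)
  qed
  have "cube_facet d i s \<subseteq> std_cube d"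
    by (simp add: cube_facet_def)
  then show ?thesis
    unfolding face_of_def using conv seg by blast
qed

lemma cube_facets_subset_faces: "cube_facets d \<subseteq> faces (std_cube d)"
  by (auto simp: cube_facets_def faces_def cube_facet_face_of)

section \<open>The coatoms of the face lattice of the cube\<close>

text \<open>From any \<open>y\<close> the segment through \<open>x\<close> can be prolonged slightly
  beyond \<open>x\<close> to a point \<open>z\<close> of the cube. Then \<open>x\<close> lies
  strictly between \<open>y\<close> and \<open>z\<close>, and the face property puts
  \<open>y\<close> into \<open>G\<close>.\<close>

lemma face_of_std_cube_interior_point:
  assumes G: "G face_of std_cube d" and x: "x \<in> G"
    and int: "\<And>i. i \<in> {1..d} \<Longrightarrow> \<bar>Poly_Mapping.lookup x i\<bar> < 1"
  shows "G = std_cube d"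
proof
  show "G \<subseteq> std_cube d" using G by (rule face_of_imp_subset)
  show "std_cube d \<subseteq> G"
  proof
    fix y assume y: "y \<in> std_cube d"
    have xc: "x \<in> std_cube d" using G x face_of_imp_subset by blast
    \<comment> \<open>The distance from \<open>x\<close> to the nearest facet hyperplane, capped at
      1; the extra 1 keeps the set nonempty for \<open>d = 0\<close>.\<close>
    define m where "m = Min (insert 1 ((\<lambda>i. 1 - \<bar>Poly_Mapping.lookup x i\<bar>) ` {1..d}))"
    have m: "m > 0" and mle: "\<And>i. i \<in> {1..d} \<Longrightarrow> m \<le> 1 - \<bar>Poly_Mapping.lookup x i\<bar>"
      using int by (auto simp: m_def simp del: Min_insert intro: Min_le)
    \<comment> \<open>Coordinates of \<open>x\<close> and \<open>y\<close> differ by at most 2, so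
      half of \<open>m\<close> moves each coordinate by at most \<open>m\<close>.\<close>
    define e where "e = m / 2"
    define z where "z = x + e *\<^sub>R (x - y)"
    have e: "e > 0" using m by (simp add: e_def)
    have z: "z \<in> std_cube d"
      unfolding mem_std_cube_iff
    proof
      fix i
      show "\<bar>Poly_Mapping.lookup z i\<bar> \<le> (if i \<in> {1..d} then 1 else 0)"
      proof (cases "i \<in> {1..d}")
        case True
        let ?a = "Poly_Mapping.lookup x i" and ?b = "Poly_Mapping.lookup y i"
        have ab: "\<bar>?a\<bar> \<le> 1" "\<bar>?b\<bar> \<le> 1"
          using xc y True unfolding mem_std_cube_iff by presburger+
        have "\<bar>e * (?a - ?b)\<bar> \<le> e * 2"
          using e ab by (subst abs_mult) (intro mult_mono, auto)
        then have "\<bar>?a + e * (?a - ?b)\<bar> \<le> 1"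
          using mle[OF True] unfolding e_def by linarith
        then show ?thesis
          using True by (simp add: z_def lookup_add lookup_minus)
      next
        case False
        then have "Poly_Mapping.lookup x i = 0" "Poly_Mapping.lookup y i = 0"
          using xc y unfolding mem_std_cube_iff by (metis abs_le_zero_iff)+
        then show ?thesis by (simp add: z_def lookup_add lookup_minus)
      qed
    qed
    show "y \<in> G"
    proof (cases "x = y")
      case False
      then have "y \<noteq> z"
      proof -
        have "z - y = (1 + e) *\<^sub>R (x - y)"
          by (simp add: z_def algebra_simps)
        then show ?thesis using False e by auto
      qed
      \<comment> \<open>The weight comes from solving \<open>z = x + e *\<^sub>R (x - y)\<close> for
        \<open>x\<close>.\<close>
      have "x = (1 - 1 / (1 + e)) *\<^sub>R y + (1 / (1 + e)) *\<^sub>R z"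
      proof (rule poly_mapping_eqI)
        fix k
        define u where "u = 1 / (1 + e)"
        have "u * (1 + e) = 1"
          using e by (simp add: u_def)
        moreover have "(1 - u) * b + u * (a + e * (a - b)) = b * (1 - u * (1 + e)) + a * (u * (1 + e))"
          for a b
          by (simp add: algebra_simps)
        ultimately show "Poly_Mapping.lookup x k =
          Poly_Mapping.lookup ((1 - 1 / (1 + e)) *\<^sub>R y + (1 / (1 + e)) *\<^sub>R z) k"
          by (simp add: z_def lookup_add lookup_minus flip: u_def)
      qed
      then have "x \<in> open_segment y z"
        unfolding in_segment using e \<open>y \<noteq> z\<close> by (intro conjI exI[of _ "1 / (1 + e)"]) auto
      then show ?thesis
        using face_ofD[OF G _ y z x] by blast
    qed (use x in simp)
  qed
qed

text \<open>Averaging points of the face that avoid the individual facets yields an interior point.\<close>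

lemma proper_face_subset_cube_facet:
  assumes G: "G face_of std_cube d" "G \<noteq> std_cube d" "G \<noteq> {}"
  obtains H where "H \<in> cube_facets d" "G \<subseteq> H"
proof (rule ccontr)
  assume "\<not> thesis"
  then have no: "\<not> G \<subseteq> H" if "H \<in> cube_facets d" for H
    using that \<open>\<And>H. H \<in> cube_facets d \<Longrightarrow> G \<subseteq> H \<Longrightarrow> thesis\<close> by blast
  define I where "I = {1..d} \<times> {-1, 1::real}"
  have GC: "G \<subseteq> std_cube d" using G face_of_imp_subset by blast
  have "\<exists>x\<in>G. Poly_Mapping.lookup x i \<noteq> s" if "(i, s) \<in> I" for i s
    using no[of "cube_facet d i s"] that GC unfolding cube_facets_def I_def cube_facet_def by blast
  then obtain p where p: "\<And>i s. (i, s) \<in> I \<Longrightarrow> p (i, s) \<in> G \<and> Poly_Mapping.lookup (p (i, s)) i \<noteq> s"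
    by (metis prod.case_eq_if prod.collapse fst_conv snd_conv)
  obtain x0 where x0: "x0 \<in> G" using G by blast
  have "finite I" by (simp add: I_def)
  show False
  proof (cases "I = {}")
    case True
    then have "d = 0" by (auto simp: I_def)
    then show False using face_of_std_cube_interior_point[OF G(1) x0] G(2) by simp
  next
    case False
    define c where "c = 1 / real (card I)"
    have c: "c > 0" "(\<Sum>j\<in>I. c) = 1"
      using False \<open>finite I\<close> by (auto simp: c_def card_gt_0_iff)
    define x where "x = (\<Sum>j\<in>I. c *\<^sub>R p j)"
    have "x \<in> G"
      unfolding x_def
      using G(1) \<open>finite I\<close> c p by (intro convex_sum) (auto simp: face_of_imp_convex)
    moreover have "\<bar>Poly_Mapping.lookup x i\<bar> < 1" if i: "i \<in> {1..d}" for i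
    proof -
      have le: "\<bar>Poly_Mapping.lookup (p j) i\<bar> \<le> 1" if "j \<in> I" for j
        using p[of "fst j" "snd j"] that GC i unfolding mem_std_cube_iff subset_iff
        by (metis prod.collapse)
      have strict: "s * Poly_Mapping.lookup x i < 1" if s: "s \<in> {-1, 1}" for s
      proof -
        have I: "(i, s) \<in> I" using i s by (auto simp: I_def)
        have "s * Poly_Mapping.lookup x i = (\<Sum>j\<in>I. c * (s * Poly_Mapping.lookup (p j) i))"
          by (simp add: x_def lookup_sum_poly_mapping sum_distrib_left algebra_simps)
        also have "\<dots> < (\<Sum>j\<in>I. c)"
        proof (rule sum_strict_mono_ex1[OF \<open>finite I\<close>])
          show "\<forall>j\<in>I. c * (s * Poly_Mapping.lookup (p j) i) \<le> c"
            using le s c by (auto simp: abs_le_iff mult_le_cancel_left1 mult_le_cancel_left2)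
          have "s * Poly_Mapping.lookup (p (i, s)) i < 1"
            using le[OF I] p[OF I] s by auto
          then show "\<exists>j\<in>I. c * (s * Poly_Mapping.lookup (p j) i) < c"
            using I c by (intro bexI[of _ "(i, s)"]) auto
        qed
        finally show ?thesis using c by simp
      qed
      show ?thesis using strict[of 1] strict[of "-1"] by auto
    qed
    ultimately show False
      using face_of_std_cube_interior_point[OF G(1)] G(2) by blast
  qed
qed

lemma zero_in_std_cube: "0 \<in> std_cube d"
  by (simp add: mem_std_cube_iff)

lemma cube_facet_neq_std_cube: "s \<in> {-1, 1} \<Longrightarrow> cube_facet d i s \<noteq> std_cube d"
  using zero_in_std_cube[of d] unfolding cube_facet_def by force

text \<open>A nonempty proper face lies in some cube facet. If it contains a cube facet as well,
  then it is squeezed between two of them, which must coincide.\<close>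

lemma cube_facets_subset_all_facets: "cube_facets d \<subseteq> all_facets (std_cube d)"
proof
  fix G assume "G \<in> cube_facets d"
  then obtain i s where G: "G = cube_facet d i s" and ij: "i \<in> {1..d}" "s \<in> {-1, 1}"
    by (auto simp: cube_facets_def)
  have max: "H = std_cube d \<or> H = G" if H: "H \<in> faces (std_cube d)" "G \<subseteq> H" for H
  proof (rule ccontr)
    assume *: "\<not> ?thesis"
    \<comment> \<open>An empty facet would be contained in the opposite one, with sign
      \<open>-s\<close>.\<close>
    have "G \<noteq> {}"
      using cube_facet_subset_iff[OF ij, of "-s" i] ij unfolding G by auto
    then obtain K where K: "K \<in> cube_facets d" "H \<subseteq> K"
      using proper_face_subset_cube_facet[of H d] H * by (auto simp: faces_def)
    then obtain j t where jt: "K = cube_facet d j t" "t \<in> {-1, 1}"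
      by (auto simp: cube_facets_def)
    have "cube_facet d i s \<subseteq> cube_facet d j t"
      using H(2) K(2) unfolding G jt(1) by (rule order_trans)
    then have "G = K"
      using cube_facet_subset_iff[OF ij jt(2)] unfolding G jt(1) by simp
    then show False using * H K by simp
  qed
  have "G \<in> faces (std_cube d)" "G \<noteq> std_cube d"
    using cube_facet_face_of[OF ij(2)] cube_facet_neq_std_cube[OF ij(2)]
    by (simp_all add: G faces_def)
  then show "G \<in> all_facets (std_cube d)"
    unfolding mem_all_facets_iff[OF convex_std_cube] by (intro conjI ballI impI max)
qed

text \<open>A nonempty coatom lies in some cube facet and equals it by maximality. The empty face
  has to be set aside, being a coatom for \<open>d = 0\<close>.\<close>

lemma nonempty_mem_all_facets_std_cube:
  assumes "G \<in> all_facets (std_cube d)" "G \<noteq> {}"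
  shows "G \<in> cube_facets d"
proof -
  have G: "G face_of std_cube d" "G \<noteq> std_cube d"
    and max: "\<And>H. H \<in> faces (std_cube d) \<Longrightarrow> G \<subseteq> H \<Longrightarrow> H = std_cube d \<or> H = G"
    using assms(1) unfolding mem_all_facets_iff[OF convex_std_cube] by (auto simp: faces_def)
  obtain H where H: "H \<in> cube_facets d" "G \<subseteq> H"
    using proper_face_subset_cube_facet[OF G assms(2)] .
  have "H \<in> all_facets (std_cube d)"
    using H(1) cube_facets_subset_all_facets by (rule rev_subsetD)
  then have "H \<noteq> std_cube d" "H \<in> faces (std_cube d)"
    unfolding mem_all_facets_iff[OF convex_std_cube] by blast+
  then have "H = G"
    using max[OF _ H(2)] by blast
  then show ?thesis
    using H(1) by simp
qed

lemma empty_notin_cube_facets: "{} \<notin> cube_facets d"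
proof
  assume "{} \<in> cube_facets d"
  then obtain i s where i: "i \<in> {1..d}" "s \<in> {-1, 1}" and "{} = cube_facet d i s"
    unfolding cube_facets_def by blast
  then have "cube_facet d i s \<subseteq> cube_facet d i (-s)"
    by blast
  then show False
    using i cube_facet_subset_iff[OF i, of "-s" i] by force
qed

lemma cube_facets_antichain:
  assumes "G \<in> cube_facets d" "H \<in> cube_facets d" "G \<subseteq> H"
  shows "G = H"
proof -
  obtain i s where G: "G = cube_facet d i s" "i \<in> {1..d}" "s \<in> {-1, 1}"
    using assms(1) by (auto simp: cube_facets_def)
  obtain j t where H: "H = cube_facet d j t" "t \<in> {-1, 1}"
    using assms(2) by (auto simp: cube_facets_def)
  show ?thesis
    using cube_facet_subset_iff[OF G(2,3) H(2)] assms(3) unfolding G(1) H(1) by simp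
qed

text \<open>With at least one coordinate there is a cube facet strictly between the empty face and
  the cube, so the empty face is no coatom.\<close>

lemma all_facets_std_cube:
  assumes "d > 0"
  shows "all_facets (std_cube d) = cube_facets d"
proof (intro equalityI cube_facets_subset_all_facets subsetI)
  fix G assume G: "G \<in> all_facets (std_cube d)"
  have "G \<noteq> {}"
  proof
    assume "G = {}"
    have F: "cube_facet d 1 1 \<in> cube_facets d"
      using assms unfolding cube_facets_def by force
    then have "cube_facet d 1 1 \<in> all_facets (std_cube d)"
      using cube_facets_subset_all_facets by (rule subsetD[rotated])
    then have "cube_facet d 1 1 = {}"
      using G unfolding \<open>G = {}\<close> mem_all_facets_iff[OF convex_std_cube] by blast
    then show False
      using F empty_notin_cube_facets by simp
  qed
  then show "G \<in> cube_facets d"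
    by (rule nonempty_mem_all_facets_std_cube[OF G])
qed

section \<open>Sets of facets without opposing pairs and the reciprocal domains of the cube\<close>

definition opposing_free :: "nat \<Rightarrow> (nat \<Rightarrow>\<^sub>0 real) set set \<Rightarrow> bool" where
  "opposing_free d S \<longleftrightarrow> (\<forall>i\<in>{1..d}. cube_facet d i 1 \<notin> S \<or> cube_facet d i (-1) \<notin> S)"

text \<open>Filters out the members of the sets in the third condition that are not cube facets:
  small maximal faces of \<open>D\<close>, or the empty face, which has codimension 1 in a
  point.\<close>

lemma opposing_free_Int_cube_facets: "opposing_free d (X \<inter> cube_facets d) \<longleftrightarrow> opposing_free d X"
proof -
  have "cube_facet d i 1 \<in> cube_facets d" "cube_facet d i (-1) \<in> cube_facets d" if "i \<in> {1..d}" for i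
    using that unfolding cube_facets_def by blast+
  then show ?thesis
    by (simp add: opposing_free_def)
qed

lemma opposing_freeE:
  assumes "S \<subseteq> cube_facets d" "opposing_free d S"
  obtains I \<sigma> where "I \<subseteq> {1..d}" "\<And>i. \<sigma> i \<in> {-1, 1::real}" "S = (\<lambda>i. cube_facet d i (\<sigma> i)) ` I"
proof -
  define I where "I = {i \<in> {1..d}. cube_facet d i 1 \<in> S \<or> cube_facet d i (-1) \<in> S}"
  \<comment> \<open>The value -1 at indices outside \<open>I\<close> is a mere default; it makes
    \<open>\<sigma>\<close> a sign at every index.\<close>
  define \<sigma> where "\<sigma> i = (if cube_facet d i 1 \<in> S then 1 else -1 :: real)" for i
  have "S = (\<lambda>i. cube_facet d i (\<sigma> i)) ` I"
  proof (intro equalityI subsetI)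
    fix G assume G: "G \<in> S"
    then have "G \<in> cube_facets d" using assms(1) by (rule rev_subsetD)
    then obtain i s where i: "i \<in> {1..d}" "s \<in> {-1, 1}" "G = cube_facet d i s"
      by (auto simp: cube_facets_def)
    then have "i \<in> I" using G by (auto simp: I_def)
    moreover have "s = \<sigma> i"
      using assms(2) G i unfolding opposing_free_def \<sigma>_def by auto
    ultimately show "G \<in> (\<lambda>i. cube_facet d i (\<sigma> i)) ` I"
      using i(3) by simp
  qed (auto simp: I_def \<sigma>_def)
  then show ?thesis
    by (intro that[of I \<sigma>]) (auto simp: I_def \<sigma>_def)
qed

text \<open>The face is the intersection of the facets in \<open>S\<close>; the point of it with as many coordinates
  \<open>0\<close> as possible lies on no other facet.\<close>

lemma opposing_free_imp_facets_above:
  assumes "S \<subseteq> cube_facets d" "opposing_free d S"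
  obtains F where "F \<in> faces (std_cube d)" "facets_above F (std_cube d) = S"
proof -
  obtain I \<sigma> where I: "I \<subseteq> {1..d}" and \<sigma>: "\<And>i. \<sigma> i \<in> {-1, 1::real}"
    and S: "S = (\<lambda>i. cube_facet d i (\<sigma> i)) ` I"
    using opposing_freeE[OF assms] by metis
  define F where "F = \<Inter>(insert (std_cube d) S)"
  have "F face_of std_cube d"
    unfolding F_def
    using assms(1) cube_facets_subset_faces
    by (intro face_of_Inter) (auto simp: faces_def face_of_refl convex_std_cube)
  then have F: "F \<in> faces (std_cube d)" by (simp add: faces_def)
  define p where "p = (\<Sum>i\<in>I. Poly_Mapping.single i (\<sigma> i))"
  have "finite I" using I by (rule finite_subset) simp
  then have p: "Poly_Mapping.lookup p i = (if i \<in> I then \<sigma> i else 0)" for i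
    by (simp add: p_def lookup_sum_poly_mapping lookup_single when_def sum.delta')
  have "p \<in> std_cube d"
    unfolding mem_std_cube_iff
  proof
    fix i
    show "\<bar>Poly_Mapping.lookup p i\<bar> \<le> (if i \<in> {1..d} then 1 else 0)"
      using I \<sigma>[of i] by (auto simp: p)
  qed
  then have pF: "p \<in> F"
    by (auto simp: F_def S cube_facet_def p)
  have "facets_above F (std_cube d) = S"
    unfolding facets_above_eq[OF convex_std_cube F]
  proof (intro equalityI subsetI)
    fix G assume "G \<in> {G \<in> all_facets (std_cube d). F \<subseteq> G}"
    then have G: "G \<in> all_facets (std_cube d)" "p \<in> G" using pF by auto
    then have "G \<in> cube_facets d"
      by (intro nonempty_mem_all_facets_std_cube) auto
    then obtain i s where i: "s \<in> {-1, 1}" "G = cube_facet d i s"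
      by (auto simp: cube_facets_def)
    then have "Poly_Mapping.lookup p i = s" using G(2) by (simp add: cube_facet_def)
    then have "i \<in> I" "s = \<sigma> i" using i(1) by (auto simp: p split: if_splits)
    then show "G \<in> S" using i(2) by (simp add: S)
  next
    fix G assume "G \<in> S"
    moreover from this have "G \<in> all_facets (std_cube d)"
      using assms(1) cube_facets_subset_all_facets by blast
    ultimately show "G \<in> {G \<in> all_facets (std_cube d). F \<subseteq> G}"
      by (auto simp: F_def)
  qed
  then show ?thesis using F that by simp
qed

lemma opposing_free_facets_above:
  assumes "F \<in> faces (std_cube d)" "F \<noteq> {}"
  shows "facets_above F (std_cube d) \<subseteq> cube_facets d" "opposing_free d (facets_above F (std_cube d))"
proof -
  show "facets_above F (std_cube d) \<subseteq> cube_facets d"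
    unfolding facets_above_eq[OF convex_std_cube assms(1)]
    using nonempty_mem_all_facets_std_cube assms(2) by auto
  obtain x where "x \<in> F" using assms(2) by blast
  have False if "cube_facet d i 1 \<in> facets_above F (std_cube d)"
    "cube_facet d i (-1) \<in> facets_above F (std_cube d)" for i
  proof -
    have "x \<in> cube_facet d i 1" "x \<in> cube_facet d i (-1)"
      using that \<open>x \<in> F\<close> unfolding facets_above_eq[OF convex_std_cube assms(1)] by blast+
    then show False by (simp add: cube_facet_def)
  qed
  then show "opposing_free d (facets_above F (std_cube d))"
    unfolding opposing_free_def by (intro ballI) blast
qed

text \<open>The common ground of the three conditions: each is compared with this property of a set
  of cube facets generating the image of \<open>D\<close>.\<close>

definition stable_facets :: "nat \<Rightarrow> (nat \<Rightarrow>\<^sub>0 real) set set \<Rightarrow> bool" where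
  "stable_facets d S \<longleftrightarrow>
     S \<subseteq> cube_facets d \<and> (opposing_free d S \<or> opposing_free d (cube_facets d - S))"

lemma opposing_free_empty [simp]: "opposing_free d {}"
  by (simp add: opposing_free_def)

lemma stable_facets_imp_reciprocal_domain:
  assumes "stable_facets d S"
  obtains F where "F \<in> faces (std_cube d)"
    "S = facets_above F (std_cube d) \<or> S = all_facets (std_cube d) - facets_above F (std_cube d)"
proof (cases "opposing_free d S")
  case True
  with assms show ?thesis
    using that by (auto simp: stable_facets_def elim: opposing_free_imp_facets_above)
next
  case False
  with assms have S: "S \<subseteq> cube_facets d" "opposing_free d (cube_facets d - S)" and "S \<noteq> {}"
    by (auto simp: stable_facets_def)
  \<comment> \<open>Positive dimension makes the coatoms exactly the cube facets, so that
    complementing twice returns \<open>S\<close>.\<close>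
  then have "d > 0"
    by (auto simp: cube_facets_def)
  obtain F where "F \<in> faces (std_cube d)" "facets_above F (std_cube d) = cube_facets d - S"
    using opposing_free_imp_facets_above[OF Diff_subset S(2)] .
  then show ?thesis
    using that S(1) by (simp add: all_facets_std_cube[OF \<open>d > 0\<close>] double_diff)
qed

text \<open>For \<open>d = 0\<close> the only facet is the empty face, which is not a cube facet.\<close>

lemma reciprocal_domain_imp_stable_facets:
  assumes F: "F \<in> faces (std_cube d)"
    and E: "E = generated_complex (facets_above F (std_cube d)) \<or>
      E = generated_complex (all_facets (std_cube d) - facets_above F (std_cube d))"
    and "d = 0 \<Longrightarrow> E \<noteq> {{}}"
  obtains S where "stable_facets d S" "E = generated_complex S"
proof (cases "d = 0")
  case True
  then have "cube_facets d = {}" by (simp add: cube_facets_def)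
  then have "all_facets (std_cube d) \<subseteq> {{}}"
    using nonempty_mem_all_facets_std_cube[of _ d] by auto
  then have "facets_above F (std_cube d) \<subseteq> {{}}"
    unfolding facets_above_eq[OF convex_std_cube F] by blast
  then obtain X where X: "E = generated_complex X" "X \<subseteq> {{}}"
    using E \<open>all_facets (std_cube d) \<subseteq> {{}}\<close> by (elim disjE) blast+
  have "generated_complex {{} :: (nat \<Rightarrow>\<^sub>0 real) set} = {{}}"
    by (simp add: generated_complex_def faces_def)
  then have "X \<noteq> {{}}"
    using assms(3)[OF True] X(1) by metis
  then have "X = {}"
    using X(2) unfolding subset_singleton_iff by simp
  then have "E = generated_complex {}"
    using X(1) by simp
  then show ?thesis
    using that[of "{}"] by (simp add: stable_facets_def)
next
  case False
  then have all: "all_facets (std_cube d) = cube_facets d"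
    by (simp add: all_facets_std_cube)
  have above: "stable_facets d (facets_above F (std_cube d)) \<and>
    stable_facets d (cube_facets d - facets_above F (std_cube d))"
  proof (cases "F = {}")
    case True
    have "facets_above F (std_cube d) = cube_facets d"
      unfolding facets_above_eq[OF convex_std_cube F] all by (simp add: True)
    then show ?thesis by (simp add: stable_facets_def)
  next
    case False
    then show ?thesis
      using opposing_free_facets_above[OF F] by (simp add: stable_facets_def double_diff)
  qed
  then show ?thesis
    using E that unfolding all by blast
qed

section \<open>Signed permutations\<close>

text \<open>Coordinates are pulled back along \<open>p\<close>, with the sign attached to the new
  index: the hyperplane of coordinate \<open>p i\<close> moves to that of \<open>i\<close>. Since
  \<open>mapp\<close> acts on the support only, it matters that \<open>e i\<close> times 0 is
  0.\<close>

definition signed_permutation :: "(nat \<Rightarrow> nat) \<Rightarrow> (nat \<Rightarrow> real) \<Rightarrow> (nat \<Rightarrow>\<^sub>0 real) \<Rightarrow> (nat \<Rightarrow>\<^sub>0 real)" where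
  "signed_permutation p e x = Poly_Mapping.mapp (\<lambda>i c. e i * c) (Poly_Mapping.map_key p x)"

lemma lookup_signed_permutation:
  assumes "inj p"
  shows "Poly_Mapping.lookup (signed_permutation p e x) i = e i * Poly_Mapping.lookup x (p i)"
  by (simp add: signed_permutation_def lookup_mapp map_key.rep_eq[OF assms] in_keys_iff when_def)

lemma signed_permutation_image:
  assumes p: "bij p" and e: "\<And>i. e i \<in> {-1, 1::real}"
    and AB: "\<And>x. signed_permutation p e x \<in> B \<longleftrightarrow> x \<in> A"
  shows "signed_permutation p e ` A = B"
proof -
  have "\<exists>x. y = signed_permutation p e x" for y
  proof (rule exI poly_mapping_eqI)+
    fix i
    \<comment> \<open>The inverse signed permutation applied to \<open>y\<close>: the signs travel
      with their indices, and each sign is its own inverse.\<close>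
    let ?x = "signed_permutation (inv p) (\<lambda>i. e (inv p i)) y"
    have "inv p (p i) = i" using p by (simp add: bij_is_inj)
    moreover have "e i * e i = 1" using e[of i] by auto
    ultimately show "Poly_Mapping.lookup y i = Poly_Mapping.lookup (signed_permutation p e ?x) i"
      using bij_is_inj[OF p] bij_is_inj[OF bij_imp_bij_inv[OF p]]
      by (simp add: lookup_signed_permutation flip: mult.assoc)
  qed
  then have "y \<in> signed_permutation p e ` A" if "y \<in> B" for y
    using that AB by (metis imageI)
  then show ?thesis
    using AB by (intro equalityI subsetI) auto
qed

lemma linear_signed_permutation: "inj p \<Longrightarrow> linear (signed_permutation p e)"
  by (intro linearI poly_mapping_eqI)
    (simp_all add: lookup_signed_permutation lookup_add algebra_simps)

lemma inj_signed_permutation: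
  assumes p: "bij p" and e: "\<And>i. e i \<in> {-1, 1::real}"
  shows "inj (signed_permutation p e)"
proof (intro injI poly_mapping_eqI)
  fix x y k assume *: "signed_permutation p e x = signed_permutation p e y"
  obtain i where i: "k = p i" using p by (meson bij_pointE)
  have "e i \<noteq> 0" using e[of i] by auto
  then show "Poly_Mapping.lookup x k = Poly_Mapping.lookup y k"
    using arg_cong[OF *, of "\<lambda>z. Poly_Mapping.lookup z i"] p
    by (simp add: i lookup_signed_permutation bij_is_inj)
qed

lemma signed_permutation_std_cube:
  assumes p: "p permutes {1..d}" and e: "\<And>i. e i \<in> {-1, 1::real}"
  shows "signed_permutation p e ` std_cube d = std_cube d"
    and "i \<in> {1..d} \<Longrightarrow>
      signed_permutation p e ` cube_facet d (p i) s = cube_facet d i (e i * s)"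
proof -
  have bij: "bij p" using p by (rule permutes_bij)
  have "\<bar>e i\<bar> = 1" for i using e[of i] by auto
  then have lookup: "\<bar>Poly_Mapping.lookup (signed_permutation p e x) i\<bar> = \<bar>Poly_Mapping.lookup x (p i)\<bar>"
    for x i
    by (simp add: lookup_signed_permutation bij_is_inj[OF bij] abs_mult)
  have cube: "signed_permutation p e x \<in> std_cube d \<longleftrightarrow> x \<in> std_cube d" for x
  proof -
    have "signed_permutation p e x \<in> std_cube d \<longleftrightarrow>
        (\<forall>i. \<bar>Poly_Mapping.lookup x (p i)\<bar> \<le> (if p i \<in> {1..d} then 1 else 0))"
      unfolding mem_std_cube_iff lookup permutes_in_image[OF p] ..
    also have "\<dots> \<longleftrightarrow> (\<forall>j\<in>range p. \<bar>Poly_Mapping.lookup x j\<bar> \<le> (if j \<in> {1..d} then 1 else 0))"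
      unfolding ball_simps by simp
    also have "\<dots> \<longleftrightarrow> x \<in> std_cube d"
      unfolding mem_std_cube_iff bij_is_surj[OF bij] by simp
    finally show ?thesis .
  qed
  then show "signed_permutation p e ` std_cube d = std_cube d"
    by (intro signed_permutation_image bij e)
  have "e i \<noteq> 0" using e[of i] by auto
  then have "signed_permutation p e x \<in> cube_facet d i (e i * s) \<longleftrightarrow> x \<in> cube_facet d (p i) s" for x
    using bij by (simp add: cube_facet_def cube lookup_signed_permutation bij_is_inj)
  then show "signed_permutation p e ` cube_facet d (p i) s = cube_facet d i (e i * s)"
    by (intro signed_permutation_image bij e)
qed

text \<open>An injective linear map takes the faces of a set to the faces of its image, and here the
  image of the cube is the cube.\<close>

lemma inclusion_iso_signed_permutation:
  assumes p: "p permutes {1..d}" and e: "\<And>i. e i \<in> {-1, 1::real}"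
  shows "inclusion_iso ((`) (signed_permutation p e)) (faces (std_cube d)) (faces (std_cube d))"
proof -
  have bij: "bij p" using p by (rule permutes_bij)
  have inj: "inj (signed_permutation p e)"
    using bij e by (rule inj_signed_permutation)
  have "faces (signed_permutation p e ` std_cube d) = (`) (signed_permutation p e) ` faces (std_cube d)"
    unfolding faces_def
    by (rule faces_of_linear_image[OF linear_signed_permutation[OF bij_is_inj[OF bij]] inj])
  then have "(`) (signed_permutation p e) ` faces (std_cube d) = faces (std_cube d)"
    unfolding signed_permutation_std_cube(1)[OF p e] by (rule sym)
  moreover have "inj_on ((`) (signed_permutation p e)) (faces (std_cube d))"
    by (intro inj_onI) (simp add: inj_image_eq_iff[OF inj])
  ultimately show ?thesis
    by (simp add: inclusion_iso_def bij_betw_def inj_image_subset_iff[OF inj])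
qed

text \<open>A bijection from \<open>A\<close> to \<open>B\<close>, one between the complements in
  \<open>U\<close>, and the identity outside \<open>U\<close> are glued together.\<close>

lemma permutes_image_exists:
  assumes "finite U" "A \<subseteq> U" "B \<subseteq> U" "card A = card B"
  obtains p where "p permutes U" "p ` A = B"
proof -
  have fin: "finite A" "finite B" using assms by (auto intro: finite_subset)
  obtain h where h: "bij_betw h A B"
    using finite_same_card_bij[OF fin assms(4)] by blast
  have "card (U - A) = card (U - B)"
    using assms fin by (simp add: card_Diff_subset)
  then obtain k where k: "bij_betw k (U - A) (U - B)"
    using finite_same_card_bij[of "U - A" "U - B"] assms(1) by auto
  define p where "p x = (if x \<in> A then h x else if x \<in> U then k x else x)" for x
  have pA: "bij_betw p A B"
    using h by (rule bij_betw_cong[THEN iffD1, rotated]) (simp add: p_def)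
  moreover have "bij_betw p (U - A) (U - B)"
    using k by (rule bij_betw_cong[THEN iffD1, rotated]) (simp add: p_def)
  ultimately have "bij_betw p (A \<union> (U - A)) (B \<union> (U - B))"
    by (rule bij_betw_combine) blast
  then have "bij_betw p U U"
    using assms by (simp add: Un_absorb1)
  then have "p permutes U"
    by (rule bij_imp_permutes) (use assms(2) in \<open>auto simp: p_def\<close>)
  then show ?thesis
    using that pA by (simp add: bij_betw_def)
qed

text \<open>The number \<open>m\<close> depends on \<open>S\<close> alone, so a user may choose the
  target coordinates \<open>A\<close> after learning \<open>m\<close>. Both signs \<open>t\<close>
  are used: 1 to place the removed facets, -1 to place the remaining ones.\<close>

lemma straighten_opposing_free:
  assumes "S \<subseteq> cube_facets d" "opposing_free d S" "t \<in> {-1, 1::real}"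
  shows "\<exists>m\<le>d. \<forall>A\<subseteq>{1..d}. card A = m \<longrightarrow>
    (\<exists>a. inclusion_iso a (faces (std_cube d)) (faces (std_cube d)) \<and>
         a ` S = (\<lambda>i. cube_facet d i t) ` A)"
proof -
  obtain I \<sigma> where I: "I \<subseteq> {1..d}" and \<sigma>: "\<And>i. \<sigma> i \<in> {-1, 1::real}"
    and S: "S = (\<lambda>i. cube_facet d i (\<sigma> i)) ` I"
    using opposing_freeE[OF assms(1,2)] by metis
  have "card I \<le> d"
    using card_mono[OF _ I] by simp
  moreover have "\<exists>a. inclusion_iso a (faces (std_cube d)) (faces (std_cube d)) \<and>
          a ` S = (\<lambda>i. cube_facet d i t) ` A" if A: "A \<subseteq> {1..d}" "card A = card I" for A
  proof -
    obtain p where p: "p permutes {1..d}" "p ` A = I"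
      using permutes_image_exists[OF _ A(1) I A(2)] by auto
    \<comment> \<open>Chosen so that \<open>e i * \<sigma> (p i) = t\<close>, as the square of a
      sign is 1.\<close>
    define e where "e i = \<sigma> (p i) * t" for i
    have e: "e i \<in> {-1, 1}" for i
      using \<sigma>[of "p i"] assms(3) by (auto simp: e_def)
    have "(`) (signed_permutation p e) ` S =
        (\<lambda>i. signed_permutation p e ` cube_facet d (p i) (\<sigma> (p i))) ` A"
      unfolding S p(2)[symmetric] image_image ..
    also have "\<dots> = (\<lambda>i. cube_facet d i t) ` A"
    proof (rule image_cong[OF refl])
      fix i assume "i \<in> A"
      then have i: "i \<in> {1..d}" using A(1) by (rule rev_subsetD)
      have "e i * \<sigma> (p i) = t"
        using \<sigma>[of "p i"] by (auto simp: e_def)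
      then show "signed_permutation p e ` cube_facet d (p i) (\<sigma> (p i)) = cube_facet d i t"
        using signed_permutation_std_cube(2)[OF p(1) e i, where s = "\<sigma> (p i)"] by simp
    qed
    finally show ?thesis
      using inclusion_iso_signed_permutation[OF p(1) e] by (intro exI conjI)
  qed
  ultimately show ?thesis
    by (intro exI[of _ "card I"]) simp
qed

section \<open>The facets removed from half-open cubes\<close>

text \<open>Up to \<open>l = d\<close> only facets with sign 1 are removed; beyond that all of these
  are gone and only facets with sign -1 remain. One of the two sets therefore uses a single
  sign.\<close>

lemma stable_facets_removed_facets:
  assumes "l \<le> 2 * d"
  shows "stable_facets d (removed_facets d l)"
proof -
  have "removed_facets d l \<subseteq> cube_facets d"
  proof
    fix G assume "G \<in> removed_facets d l"
    then obtain i s where "G = cube_facet d i s" "i \<in> {1..d}" "s \<in> {-1, 1}"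
      using assms by (auto simp: removed_facets_def split: if_splits)
    then show "G \<in> cube_facets d"
      unfolding cube_facets_def by blast
  qed
  moreover have "opposing_free d (removed_facets d l)" if "l \<le> d"
  proof -
    have "cube_facet d i (-1) \<noteq> cube_facet d j 1" if "i \<in> {1..d}" for i j
      using cube_facet_eq_iff[OF that, of "-1" 1 j] by simp
    then show ?thesis
      using \<open>l \<le> d\<close> by (simp add: removed_facets_def opposing_free_def)
  qed
  moreover have "opposing_free d (cube_facets d - removed_facets d l)" if "\<not> l \<le> d"
  proof -
    have "cube_facet d i 1 \<in> removed_facets d l" if "i \<in> {1..d}" for i
      using that \<open>\<not> l \<le> d\<close> unfolding removed_facets_def by auto
    then show ?thesis by (simp add: opposing_free_def)
  qed
  ultimately show ?thesis
    unfolding stable_facets_def by blast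
qed

lemma stable_facets_imp_removed_facets:
  assumes "stable_facets d S"
  obtains a l where "inclusion_iso a (faces (std_cube d)) (faces (std_cube d))"
    "l \<le> 2 * d" "a ` S = removed_facets d l"
proof (cases "opposing_free d S")
  case True
  have S: "S \<subseteq> cube_facets d" using assms by (simp add: stable_facets_def)
  obtain m where m: "m \<le> d" and *: "\<forall>A\<subseteq>{1..d}. card A = m \<longrightarrow>
      (\<exists>a. inclusion_iso a (faces (std_cube d)) (faces (std_cube d)) \<and>
           a ` S = (\<lambda>i. cube_facet d i 1) ` A)"
    using straighten_opposing_free[OF S True insertI2[OF insertI1]] by (elim exE conjE)
  have "{d + 1 - m..d} \<subseteq> {1..d}" "card {d + 1 - m..d} = m"
    using m by auto
  with * obtain a where "inclusion_iso a (faces (std_cube d)) (faces (std_cube d))"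
    "a ` S = (\<lambda>i. cube_facet d i 1) ` {d + 1 - m..d}"
    by metis
  moreover have "(\<lambda>i. cube_facet d i 1) ` {d + 1 - m..d} = removed_facets d m"
    using m unfolding removed_facets_def Setcompr_eq_image by simp
  ultimately show ?thesis
    using that[of a m] m by simp
next
  case False
  let ?T = "cube_facets d - S"
  have S: "S \<subseteq> cube_facets d" "opposing_free d ?T" and "S \<noteq> {}"
    using assms False by (auto simp: stable_facets_def)
  then have "d > 0"
    by (auto simp: cube_facets_def)
  obtain m where m: "m \<le> d" and *: "\<forall>A\<subseteq>{1..d}. card A = m \<longrightarrow>
      (\<exists>a. inclusion_iso a (faces (std_cube d)) (faces (std_cube d)) \<and>
           a ` ?T = (\<lambda>i. cube_facet d i (-1)) ` A)"
    using straighten_opposing_free[OF Diff_subset S(2) insertI1] by (elim exE conjE)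
  \<comment> \<open>Negative facets are removed from the last coordinate downwards, so the
    \<open>m\<close> survivors must sit in the first \<open>m\<close> coordinates.\<close>
  have "{1..m} \<subseteq> {1..d}" "card {1..m} = m"
    using m by auto
  with * obtain a where a: "inclusion_iso a (faces (std_cube d)) (faces (std_cube d))"
    "a ` ?T = (\<lambda>i. cube_facet d i (-1)) ` {1..m}"
    by metis
  interpret face_lattice_iso a "std_cube d" "std_cube d"
    using a(1) by unfold_locales (simp_all add: convex_std_cube)
  have "a ` S = a ` (cube_facets d - ?T)"
    using S(1) by (simp add: double_diff)
  also have "\<dots> = a ` cube_facets d - a ` ?T"
    using cube_facets_subset_faces by (intro image_diff order_trans[OF Diff_subset])
  also have "\<dots> = cube_facets d - (\<lambda>i. cube_facet d i (-1)) ` {1..m}"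
    using image_all_facets unfolding a(2) all_facets_std_cube[OF \<open>d > 0\<close>] by simp
  also have "\<dots> = (\<lambda>i. cube_facet d i 1) ` {1..d} \<union> (\<lambda>i. cube_facet d i (-1)) ` {m + 1..d}"
  proof (intro equalityI subsetI)
    fix G assume G: "G \<in> cube_facets d - (\<lambda>i. cube_facet d i (-1)) ` {1..m}"
    then obtain i s where i: "i \<in> {1..d}" "G = cube_facet d i s" and s: "s = -1 \<or> s = 1"
      by (auto simp: cube_facets_def)
    show "G \<in> (\<lambda>i. cube_facet d i 1) ` {1..d} \<union> (\<lambda>i. cube_facet d i (-1)) ` {m + 1..d}"
      using s
    proof
      assume "s = -1"
      then have "i \<notin> {1..m}" using G i(2) by auto
      then have "i \<in> {m + 1..d}" using i(1) by simp
      then show ?thesis using i(2) \<open>s = -1\<close> by (intro UnI2) simp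
    next
      assume "s = 1"
      then show ?thesis using i by (intro UnI1) simp
    qed
  next
    fix G assume "G \<in> (\<lambda>i. cube_facet d i 1) ` {1..d} \<union> (\<lambda>i. cube_facet d i (-1)) ` {m + 1..d}"
    then have "\<exists>i\<in>{1..d}. \<exists>s\<in>{-1, 1}. G = cube_facet d i s \<and> (s = -1 \<longrightarrow> m < i)"
    proof
      assume "G \<in> (\<lambda>i. cube_facet d i 1) ` {1..d}"
      then obtain i where "i \<in> {1..d}" "G = cube_facet d i 1" by auto
      then show ?thesis by (intro bexI[of _ i] bexI[of _ 1]) simp_all
    next
      assume "G \<in> (\<lambda>i. cube_facet d i (-1)) ` {m + 1..d}"
      then obtain i where "i \<in> {m + 1..d}" "G = cube_facet d i (-1)" by auto
      then show ?thesis by (intro bexI[of _ i] bexI[of _ "-1"]) simp_all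
    qed
    then obtain i s where i: "i \<in> {1..d}" "s \<in> {-1, 1}" "G = cube_facet d i s"
      "s = -1 \<longrightarrow> m < i" by blast
    then have "G \<noteq> cube_facet d j (-1)" if "j \<in> {1..m}" for j
      using that cube_facet_eq_iff[OF i(1,2), of "-1" j] by auto
    then have "G \<notin> (\<lambda>i. cube_facet d i (-1)) ` {1..m}"
      by blast
    then show "G \<in> cube_facets d - (\<lambda>i. cube_facet d i (-1)) ` {1..m}"
      using i(1-3) unfolding cube_facets_def by blast
  qed
  \<comment> \<open>All \<open>d\<close> positive and the last \<open>d - m\<close> negative facets
    are removed. For \<open>m = d\<close> this is \<open>l = d\<close>, which falls under the first
    branch of \<open>removed_facets\<close>.\<close>
  also have "\<dots> = removed_facets d (2 * d - m)"
    using m by (cases "m = d") (auto simp: removed_facets_def Setcompr_eq_image)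
  finally show ?thesis
    using that[of a "2 * d - m"] a(1) by simp
qed

section \<open>Combinatorial cubes\<close>

text \<open>Dimension strictly increases along proper inclusions of faces, and codimension 1 leaves
  no room for a face strictly in between.\<close>

lemma facet_of_imp_mem_all_facets:
  fixes Q :: "'a::euclidean_space set"
  assumes "convex Q" "G facet_of Q"
  shows "G \<in> all_facets Q"
proof -
  have G: "G face_of Q" "aff_dim G = aff_dim Q - 1"
    using assms(2) by (simp_all add: facet_of_def)
  have "H = Q \<or> H = G" if H: "H face_of Q" "G \<subseteq> H" for H
  proof (rule ccontr)
    assume "\<not> ?thesis"
    moreover have "G face_of H"
      using G(1) H face_of_imp_subset by (blast intro: face_of_subset)
    ultimately show False
      using face_of_aff_dim_lt[of H G] face_of_aff_dim_lt[of Q H] face_of_imp_convex[OF H(1)]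
        assms(1) H(1) G(2) by force
  qed
  moreover have "G \<noteq> Q" using G(2) by auto
  ultimately show ?thesis
    using G(1) unfolding mem_all_facets_iff[OF assms(1)] by (simp add: faces_def)
qed

text \<open>A nonempty proper face of a polyhedron lies in a facet, to which maximality makes it
  equal. The empty face is never \<open>facet_of\<close> anything.\<close>

lemma nonempty_mem_all_facets_imp_facet_of:
  fixes Q :: "'a::euclidean_space set"
  assumes "polytope Q" "G \<in> all_facets Q" "G \<noteq> {}"
  shows "G facet_of Q"
proof -
  have G: "G face_of Q" "G \<noteq> Q" "\<And>H. H face_of Q \<Longrightarrow> G \<subseteq> H \<Longrightarrow> H = Q \<or> H = G"
    using assms(2) unfolding mem_all_facets_iff[OF polytope_imp_convex[OF assms(1)]]
    by (simp_all add: faces_def)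
  obtain F where F: "F facet_of Q" "G \<subseteq> F"
    using face_of_polyhedron_subset_facet[OF polytope_imp_polyhedron[OF assms(1)] G(1) assms(3) G(2)] .
  then have "F \<noteq> Q" by (auto simp: facet_of_def)
  then show ?thesis
    using G(3)[of F] F by (simp add: facet_of_def)
qed

locale combinatorial_cube = face_lattice_iso f Q "std_cube d"
  for f :: "'a::euclidean_space set \<Rightarrow> (nat \<Rightarrow>\<^sub>0 real) set" and Q d +
  assumes polytope: "polytope Q"
begin

text \<open>Both sides say that the face is a nonempty coatom, so the facets of \<open>Q\<close>,
  defined by dimension, are matched with those of the cube by any isomorphism of lattices.\<close>

lemma facet_of_iff:
  assumes "G \<in> faces Q"
  shows "G facet_of Q \<longleftrightarrow> f G \<in> cube_facets d"
proof
  have bot: "{} \<in> faces Q" by (simp add: faces_def)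
  have nonempty: "f G = {} \<longleftrightarrow> G = {}"
    using eq_iff[OF assms bot] by (simp add: map_bot)
  show "f G \<in> cube_facets d" if "G facet_of Q"
    using facet_of_imp_mem_all_facets[OF convex(1) that] that nonempty mem_all_facets[OF assms]
    by (intro nonempty_mem_all_facets_std_cube) (auto simp: facet_of_def)
  show "G facet_of Q" if "f G \<in> cube_facets d"
  proof (rule nonempty_mem_all_facets_imp_facet_of[OF polytope])
    show "G \<in> all_facets Q"
      using that cube_facets_subset_all_facets[of d] mem_all_facets[OF assms] by blast
    show "G \<noteq> {}"
      using that nonempty empty_notin_cube_facets[of d] by auto
  qed
qed

lemma contains_opposing_pair_iff:
  assumes "X \<subseteq> faces Q"
  shows "contains_opposing_pair d Q f X \<longleftrightarrow> \<not> opposing_free d (f ` X)"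
proof
  assume "contains_opposing_pair d Q f X"
  then obtain G H i where "G \<in> X" "H \<in> X" "i \<in> {1..d}"
    "{f G, f H} = {cube_facet d i 1, cube_facet d i (-1)}"
    unfolding contains_opposing_pair_def opposing_pair_def by blast
  then show "\<not> opposing_free d (f ` X)"
    unfolding opposing_free_def by (auto simp: doubleton_eq_iff intro!: bexI[of _ i] intro: sym)
next
  assume "\<not> opposing_free d (f ` X)"
  then obtain i where i: "i \<in> {1..d}" "cube_facet d i 1 \<in> f ` X" "cube_facet d i (-1) \<in> f ` X"
    unfolding opposing_free_def by blast
  then obtain G H where GH: "G \<in> X" "H \<in> X" "cube_facet d i 1 = f G" "cube_facet d i (-1) = f H"
    by (auto elim!: imageE)
  have "cube_facet d i 1 \<in> cube_facets d" "cube_facet d i (-1) \<in> cube_facets d"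
    using i(1) unfolding cube_facets_def by blast+
  then have "G facet_of Q" "H facet_of Q"
    using GH assms by (auto simp: facet_of_iff subset_iff)
  then have "opposing_pair d Q f G H"
    using i(1) GH unfolding opposing_pair_def by auto
  then show "contains_opposing_pair d Q f X"
    using GH(1,2) unfolding contains_opposing_pair_def by blast
qed

text \<open>Cube facets form an antichain, so one of them belongs to the complex generated by
  \<open>S\<close> only if it is in \<open>S\<close>. Among the cube facets, the codimension 1 faces
  of the relative complex thus give the complement of \<open>S\<close>, and the facets of
  \<open>D\<close> give \<open>S\<close>.\<close>

lemma no_opposing_pair_condition_iff:
  assumes D: "D \<subseteq> faces Q" "f ` D = generated_complex S" and S: "S \<subseteq> cube_facets d"
  shows "no_opposing_pair_condition d Q f D \<longleftrightarrow> stable_facets d S"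
proof -
  have gen: "generated_complex S = {G \<in> faces (std_cube d). \<exists>H\<in>S. G \<subseteq> H}"
    using S cube_facets_subset_faces by (intro generated_complex_eq) (rule order_trans)
  have mem_S: "f G \<in> f ` D \<longleftrightarrow> f G \<in> S" if "f G \<in> cube_facets d" for G
  proof
    assume "f G \<in> f ` D"
    then obtain H where "H \<in> S" "f G \<subseteq> H"
      unfolding D(2) gen by blast
    then show "f G \<in> S"
      using cube_facets_antichain[OF that, of H] S by auto
  next
    assume "f G \<in> S"
    then show "f G \<in> f ` D"
      unfolding D(2) gen using that cube_facets_subset_faces[of d] by blast
  qed
  have mem_D: "f G \<in> f ` D \<longleftrightarrow> G \<in> D" if "G \<in> faces Q" for G
    using that D(1) eq_iff[OF that] by (metis image_iff subsetD)
  have "f ` codim1_faces Q D \<inter> cube_facets d = cube_facets d - S"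
  proof (intro equalityI subsetI)
    fix K assume "K \<in> f ` codim1_faces Q D \<inter> cube_facets d"
    then obtain G where "K = f G" "G \<in> faces Q" "G \<notin> D" "K \<in> cube_facets d"
      unfolding codim1_faces_def by blast
    then show "K \<in> cube_facets d - S"
      using mem_S[of G] mem_D[of G] by simp
  next
    fix K assume K: "K \<in> cube_facets d - S"
    then have "K \<in> f ` faces Q"
      unfolding image_faces using cube_facets_subset_faces[of d] by blast
    then obtain G where G: "K = f G" "G \<in> faces Q" by (rule imageE)
    then have "G facet_of Q" "G \<notin> D"
      using K mem_S[of G] mem_D[OF G(2)] facet_of_iff[OF G(2)] by simp_all
    then have "G \<in> codim1_faces Q D"
      using G(2) by (simp add: codim1_faces_def facet_of_def)
    then show "K \<in> f ` codim1_faces Q D \<inter> cube_facets d"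
      using K G(1) by simp
  qed
  moreover have "f ` complex_facets D \<inter> cube_facets d = S"
  proof (intro equalityI subsetI)
    fix K assume "K \<in> f ` complex_facets D \<inter> cube_facets d"
    then obtain G where "K = f G" "G \<in> D" "K \<in> cube_facets d"
      unfolding complex_facets_def by blast
    then show "K \<in> S"
      using mem_S[of G] by simp
  next
    fix K assume K: "K \<in> S"
    then have cK: "K \<in> cube_facets d" using S by (rule rev_subsetD)
    have "K \<in> f ` D"
      unfolding D(2) gen using K cK cube_facets_subset_faces[of d] by blast
    then obtain G where G: "K = f G" "G \<in> D" by (rule imageE)
    have "H = G" if H: "H \<in> D" "G \<subseteq> H" for H
    proof -
      have faces: "G \<in> faces Q" "H \<in> faces Q" using G(2) H(1) D(1) by auto
      have "f H \<in> f ` D" using H(1) by (rule imageI)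
      then obtain K' where K': "K' \<in> S" "f H \<subseteq> K'"
        unfolding D(2) gen by blast
      \<comment> \<open>Now \<open>f H\<close> lies between the cube facets \<open>K\<close> and
        \<open>K'\<close>; these agree, which leaves no room above \<open>G\<close> in
        \<open>D\<close>.\<close>
      have "f G \<subseteq> f H" using le_iff[OF faces] H(2) by simp
      with K' have "K = K'"
        using cube_facets_antichain[OF cK, of K'] S G(1) by auto
      then have "f H = f G" using K' \<open>f G \<subseteq> f H\<close> G(1) by simp
      then show ?thesis using eq_iff[OF faces(2,1)] by simp
    qed
    then have "G \<in> complex_facets D"
      using G(2) by (simp add: complex_facets_def)
    then show "K \<in> f ` complex_facets D \<inter> cube_facets d"
      using cK G(1) by simp
  qed
  moreover have "codim1_faces Q D \<subseteq> faces Q" "complex_facets D \<subseteq> faces Q"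
    using D(1) by (auto simp: codim1_faces_def complex_facets_def)
  ultimately show ?thesis
    unfolding no_opposing_pair_condition_def stable_facets_def
    using S contains_opposing_pair_iff opposing_free_Int_cube_facets by metis
qed

lemma stable_facets_imp_stable_complex:
  assumes "D \<subseteq> faces Q" "f ` D = generated_complex S" "stable_facets d S"
  shows "stable_complex (faces Q) D"
proof -
  obtain F where "F \<in> faces (std_cube d)"
    "S = facets_above F (std_cube d) \<or> S = all_facets (std_cube d) - facets_above F (std_cube d)"
    using stable_facets_imp_reciprocal_domain[OF assms(3)] .
  then show ?thesis
    unfolding stable_complex_iff[OF iso convex(1) polytope_std_cube assms(1)] assms(2) by blast
qed

lemma stable_complex_imp_stable_facets:
  assumes "D \<subseteq> faces Q" "stable_complex (faces Q) D" "d \<noteq> 0 \<or> D \<noteq> {{}}"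
  shows "\<exists>S. stable_facets d S \<and> f ` D = generated_complex S"
proof -
  \<comment> \<open>As \<open>f\<close> fixes the empty face, the exclusion of \<open>{{}}\<close>
    in dimension 0 passes from \<open>D\<close> to its image.\<close>
  have "D = {{}}" if E: "f ` D = {{}}"
  proof -
    have bot: "{} \<in> faces Q" by (simp add: faces_def)
    have "G = {}" if "G \<in> D" for G
    proof -
      have "f G \<in> {{}}" using imageI[OF that, of f] unfolding E .
      then have "f G = f {}" by (simp add: map_bot)
      moreover have "G \<in> faces Q" using that assms(1) by (rule rev_subsetD)
      ultimately show ?thesis using eq_iff[OF _ bot] by simp
    qed
    moreover have "D \<noteq> {}" using E by auto
    ultimately show ?thesis by blast
  qed
  then have E: "f ` D \<noteq> {{}}" if "d = 0"
    using assms(3) that by blast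
  obtain F where F: "F \<in> faces (std_cube d)"
    "f ` D = generated_complex (facets_above F (std_cube d)) \<or>
     f ` D = generated_complex (all_facets (std_cube d) - facets_above F (std_cube d))"
    using assms(2) unfolding stable_complex_iff[OF iso convex(1) polytope_std_cube assms(1)] by blast
  show ?thesis
    by (rule reciprocal_domain_imp_stable_facets[OF F E]) (simp, intro exI conjI)
qed

end

text \<open>By finiteness every face of \<open>D\<close> lies below a maximal one, and of two nested
  faces of \<open>Q\<close> the smaller is a face of the larger.\<close>

lemma generated_complex_complex_facets:
  assumes "subcomplex D (faces Q)"
  shows "D = generated_complex (complex_facets D)"
proof (intro equalityI subsetI)
  have fin: "finite D" and down: "\<And>P G. P \<in> D \<Longrightarrow> G face_of P \<Longrightarrow> G \<in> D"
    and sub: "\<And>G. G \<in> D \<Longrightarrow> G face_of Q"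
    using assms by (auto simp: subcomplex_def polytopal_complex_def faces_def)
  show "G \<in> generated_complex (complex_facets D)" if G: "G \<in> D" for G
  proof -
    obtain M where M: "M \<in> D" "G \<subseteq> M" "\<And>H. H \<in> D \<Longrightarrow> M \<subseteq> H \<Longrightarrow> H = M"
      using finite_has_maximal2[OF fin G] by metis
    then have "M \<in> complex_facets D"
      by (simp add: complex_facets_def)
    moreover have "G face_of M"
      using sub[OF G] M(2) face_of_imp_subset[OF sub[OF M(1)]] by (rule face_of_subset)
    ultimately show ?thesis
      unfolding generated_complex_def faces_def by blast
  qed
  show "G \<in> D" if "G \<in> generated_complex (complex_facets D)" for G
    using that down unfolding generated_complex_def faces_def complex_facets_def by blast
qed

theorem lemma3p3:
  fixes d :: nat
    and Q :: "'a::euclidean_space set"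
    and f :: "'a set \<Rightarrow> (nat \<Rightarrow>\<^sub>0 real) set"
    and D :: "'a set set"
  assumes "polytope Q"
    and "inclusion_iso f (faces Q) (faces (std_cube d))"
    and "subcomplex D (faces Q)"
    and "d = 0 \<Longrightarrow> D \<noteq> {{}}"
  shows "(stable_complex (faces Q) D \<longleftrightarrow>
            (\<exists>l\<le>2 * d. has_geometric_realization d Q D (half_open_cube d l))) \<and>
         (stable_complex (faces Q) D \<longrightarrow> no_opposing_pair_condition d Q f D) \<and>
         ((\<forall>G\<in>complex_facets D. G facet_of Q) \<longrightarrow>
            no_opposing_pair_condition d Q f D \<longrightarrow> stable_complex (faces Q) D)"
proof (intro conjI iffI impI)
  \<comment> \<open>Stated for every \<open>g\<close>, because a geometric realization brings its
    own isomorphism, which may differ from \<open>f\<close>.\<close>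
  have cube: "combinatorial_cube g Q d" if "inclusion_iso g (faces Q) (faces (std_cube d))" for g
    using that assms(1)
    by unfold_locales (simp_all add: convex_std_cube polytope_imp_convex)
  interpret combinatorial_cube f Q d
    using assms(2) by (rule cube)
  have D: "D \<subseteq> faces Q" using assms(3) by (simp add: subcomplex_def)
  have realization: "has_geometric_realization d Q D (half_open_cube d l) \<longleftrightarrow>
      (\<exists>g. inclusion_iso g (faces Q) (faces (std_cube d)) \<and>
           g ` D = generated_complex (removed_facets d l))" if "l \<le> 2 * d" for l
    unfolding has_geometric_realization_def removed_facets_eq[OF that] ..
  {
    assume "stable_complex (faces Q) D"
    then obtain S where S: "stable_facets d S" "f ` D = generated_complex S"
      using stable_complex_imp_stable_facets[OF D] assms(4) by blast
    then have SC: "S \<subseteq> cube_facets d" by (simp add: stable_facets_def)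
    show "no_opposing_pair_condition d Q f D"
      using no_opposing_pair_condition_iff[OF D S(2) SC] S(1) by simp
    obtain a l where a: "inclusion_iso a (faces (std_cube d)) (faces (std_cube d))"
      and l: "l \<le> 2 * d" "a ` S = removed_facets d l"
      using stable_facets_imp_removed_facets[OF S(1)] .
    interpret a: face_lattice_iso a "std_cube d" "std_cube d"
      using a by unfold_locales (simp_all add: convex_std_cube)
    \<comment> \<open>Following \<open>f\<close> by the straightening automorphism \<open>a\<close>
      gives the isomorphism that the realization asks for.\<close>
    have "(a \<circ> f) ` D = generated_complex (removed_facets d l)"
      unfolding image_comp[symmetric] S(2) l(2)[symmetric]
      using SC cube_facets_subset_faces by (intro a.image_generated_complex) (rule order_trans)
    with inclusion_iso_compose[OF iso a]
    have "has_geometric_realization d Q D (half_open_cube d l)"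
      unfolding realization[OF l(1)] by (intro exI conjI)
    then show "\<exists>l\<le>2 * d. has_geometric_realization d Q D (half_open_cube d l)"
      using l(1) by (intro exI conjI)
  }
  show "stable_complex (faces Q) D"
    if "\<exists>l\<le>2 * d. has_geometric_realization d Q D (half_open_cube d l)"
  proof -
    obtain l where l: "l \<le> 2 * d" and geo: "has_geometric_realization d Q D (half_open_cube d l)"
      using \<open>\<exists>l\<le>2 * d. has_geometric_realization d Q D (half_open_cube d l)\<close> by (elim exE conjE)
    obtain g where g: "inclusion_iso g (faces Q) (faces (std_cube d))"
      "g ` D = generated_complex (removed_facets d l)"
      using geo unfolding realization[OF l] by (elim exE conjE)
    show ?thesis
      using combinatorial_cube.stable_facets_imp_stable_complex[OF cube[OF g(1)] D g(2)]
        stable_facets_removed_facets[OF l] .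
  qed
  show "stable_complex (faces Q) D"
    if facets: "\<forall>G\<in>complex_facets D. G facet_of Q" and cond: "no_opposing_pair_condition d Q f D"
  proof -
    have sub: "complex_facets D \<subseteq> faces Q"
      using D by (auto simp: complex_facets_def)
    have gen: "f ` D = generated_complex (f ` complex_facets D)"
      unfolding image_generated_complex[OF sub, symmetric]
        generated_complex_complex_facets[OF assms(3), symmetric] ..
    \<comment> \<open>Here the assumption on the facets of \<open>D\<close> enters: it provides a
      generating set consisting of cube facets only.\<close>
    have "f ` complex_facets D \<subseteq> cube_facets d"
      using facets sub facet_of_iff by blast
    then have "stable_facets d (f ` complex_facets D)"
      using no_opposing_pair_condition_iff[OF D gen] cond by simp
    then show ?thesis
      by (rule stable_facets_imp_stable_complex[OF D gen])
  qed
qed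

end
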